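(* Let $F$ be a field of characteristic different from $2$ and $3$, and let $E : y^2 = x^3 + ax + b$ (with $a,b\in F$) be an elliptic curve over $F$. Let $$C(u,v) = \frac{(3av^2 + 9buv - a^2u^2)^3}{27a^3(v^3 + au^2v + bu^3)^2}.$$ Let $E'$ be an elliptic curve over $F$. For a point $(u,v)\in\mathbf{P}^1(F)$ consider the conditions (i) (defined if $a \neq 0$) $\quad\dfrac{j(E')}{j(E)} = C(u,v)$; (ii) (defined if $b \neq 0$) $\quad\dfrac{j(E')}{j(E) - 1728} = \dfrac{-4\,C(u,v)\,a^3}{27b^2}$, where in (ii) the expression $C(u,v)a^3$ is read as $\dfrac{(3av^2 + 9buv - a^2u^2)^3}{27(v^3 + au^2v + bu^3)^2}$ (also when $a=0$), and where each equality is understood to include the requirement $v^3 + au^2v + bu^3\neq 0$. If $j(E') \neq 0, 1728$, and for some $(u,v) \in \mathbf{P}^1(F)$ either $a\neq 0$ and (i) holds, or $b\neq 0$ and (ii) holds, then $E'[2] \cong E[2]$ as $G_F$-modules. Conversely, if $E'[2] \cong E[2]$ as $G_F$-modules, then there is a point $(u,v) \in \mathbf{P}^1(F)$ such that $j(E')$ satisfies (i) if $a \neq 0$ and (ii) if $b \neq 0$.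
   Context: $F^{\mathrm{sep}}$ denotes a separable closure of $F$ and $G_F = \mathrm{Gal}(F^{\mathrm{sep}}/F)$. For an elliptic curve $E$ over $F$, $j(E)$ is its $j$-invariant, and $E[2]$ is the $G_F$-module of $2$-torsion points of $E(F^{\mathrm{sep}})$. For $E: y^2=x^3+ax+b$ one has $j(E) = 1728\cdot 4a^3/(4a^3+27b^2)$, so $j(E)\ne 0$ iff $a\neq 0$, and $j(E)\neq 1728$ iff $b\neq 0$. Points of $\mathbf{P}^1(F)$ are written $(u,v)$ with $u,v\in F$ not both zero, up to common scaling; $C(u,v)$ depends only on the point of $\mathbf{P}^1(F)$ because its numerator and denominator are both homogeneous of degree $6$ in $(u,v)$. *)

theory Defs
  imports "HOL-Algebra.Algebraic_Closure_Type" "HOL-Algebra.Bij"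
begin

subsection \<open>Separable closure and absolute Galois group\<close>

text \<open>The separable closure of the field \<open>'a\<close> is realised inside its algebraic closure
  \<open>'a alg_closure\<close>: an element is separable if its minimal polynomial has only simple roots.
  Up to a unit, the minimal polynomial is the irreducible polynomial vanishing at the element.\<close>

definition sep_closure :: "'a::field alg_closure set" where
  "sep_closure = {x. \<exists>p::'a poly. Factorial_Ring.irreducible p \<and>
     poly (map_poly to_ac p) x = 0 \<and> rsquarefree (map_poly to_ac p)}"

definition abs_galois_group :: "('a::field alg_closure \<Rightarrow> 'a alg_closure) monoid" where
  "abs_galois_group = (BijGroup sep_closure)
     \<lparr>carrier := {\<sigma> \<in> Bij sep_closure.
        (\<forall>x\<in>sep_closure. \<forall>y\<in>sep_closure. \<sigma> (x + y) = \<sigma> x + \<sigma> y \<and> \<sigma> (x * y) = \<sigma> x * \<sigma> y) \<and>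
        (\<forall>c. \<sigma> (to_ac c) = to_ac c)}\<rparr>"


subsection \<open>Weierstrass curves\<close>

text \<open>\<open>Weierstrass a1 a2 a3 a4 a6\<close> stands for
  $y^2 + a_1 x y + a_3 y = x^3 + a_2 x^2 + a_4 x + a_6$.\<close>

datatype 'k weierstrass =
  Weierstrass (coeff_a1: 'k) (coeff_a2: 'k) (coeff_a3: 'k) (coeff_a4: 'k) (coeff_a6: 'k)

definition short_weierstrass :: "'k::field \<Rightarrow> 'k \<Rightarrow> 'k weierstrass" where
  "short_weierstrass a b = Weierstrass 0 0 0 a b"

fun weierstrass_c4 :: "'k::field weierstrass \<Rightarrow> 'k" where
  "weierstrass_c4 (Weierstrass a1 a2 a3 a4 a6) =
     (let b2 = a1^2 + 4 * a2; b4 = 2 * a4 + a1 * a3 in b2^2 - 24 * b4)"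

fun weierstrass_disc :: "'k::field weierstrass \<Rightarrow> 'k" where
  "weierstrass_disc (Weierstrass a1 a2 a3 a4 a6) =
     (let b2 = a1^2 + 4 * a2;
          b4 = 2 * a4 + a1 * a3;
          b6 = a3^2 + 4 * a6;
          b8 = a1^2 * a6 + 4 * a2 * a6 - a1 * a3 * a4 + a2 * a3^2 - a4^2
      in - (b2^2 * b8) - 8 * b4^3 - 27 * b6^2 + 9 * b2 * b4 * b6)"

definition elliptic_curve :: "'k::field weierstrass \<Rightarrow> bool" where
  "elliptic_curve E \<longleftrightarrow> weierstrass_disc E \<noteq> 0"

definition j_invariant :: "'k::field weierstrass \<Rightarrow> 'k" where
  "j_invariant E = weierstrass_c4 E ^ 3 / weierstrass_disc E"

lemma weierstrass_disc_short:
  "weierstrass_disc (short_weierstrass a b) = - 16 * (4 * a^3 + 27 * b^2)"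
  by (simp add: short_weierstrass_def Let_def power_mult_distrib algebra_simps)

lemma j_invariant_short:
  fixes a b :: "'k::field"
  assumes "(2::'k) \<noteq> 0"
  shows "j_invariant (short_weierstrass a b) = 1728 * (4 * a^3) / (4 * a^3 + 27 * b^2)"
proof -
  have "(16::'k) = 2^4" by simp
  with assms have nz: "(16::'k) \<noteq> 0" by (metis power_not_zero)
  have "weierstrass_c4 (short_weierstrass a b) ^ 3 = - 16 * (1728 * (4 * a^3))"
    by (simp add: short_weierstrass_def Let_def power_mult_distrib)
  then show ?thesis
    unfolding j_invariant_def weierstrass_disc_short using nz
    by (simp only: mult_divide_mult_cancel_left neg_equal_0_iff_equal not_False_eq_True)
qed


subsection \<open>Points, group law and 2-torsion\<close>

datatype 'k point = Infinity | Affine 'k 'k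

fun on_curve :: "'k::field weierstrass \<Rightarrow> 'k point \<Rightarrow> bool" where
  "on_curve _ Infinity \<longleftrightarrow> True"
| "on_curve (Weierstrass a1 a2 a3 a4 a6) (Affine x y) \<longleftrightarrow>
     y^2 + a1 * x * y + a3 * y = x^3 + a2 * x^2 + a4 * x + a6"

text \<open>The chord-tangent law; \<open>l\<close> is the slope of the line through the two points
  (the tangent if they coincide).\<close>

fun point_add :: "'k::field weierstrass \<Rightarrow> 'k point \<Rightarrow> 'k point \<Rightarrow> 'k point" where
  "point_add _ Infinity Q = Q"
| "point_add _ P Infinity = P"
| "point_add (Weierstrass a1 a2 a3 a4 a6) (Affine x1 y1) (Affine x2 y2) =
     (if x1 = x2 \<and> y1 + y2 + a1 * x2 + a3 = 0 then Infinity
      else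
        let l = (if x1 = x2
                 then (3 * x1^2 + 2 * a2 * x1 + a4 - a1 * y1) / (2 * y1 + a1 * x1 + a3)
                 else (y2 - y1) / (x2 - x1));
            x3 = l^2 + a1 * l - a2 - x1 - x2;
            y3 = - (l + a1) * x3 - (y1 - l * x1) - a3
        in Affine x3 y3)"

definition sep_points :: "'a::field weierstrass \<Rightarrow> 'a alg_closure point set" where
  "sep_points E = {P. on_curve (map_weierstrass to_ac E) P \<and> set_point P \<subseteq> sep_closure}"

definition two_torsion :: "'a::field weierstrass \<Rightarrow> 'a alg_closure point monoid" where
  "two_torsion E =
     \<lparr>carrier = {P \<in> sep_points E. point_add (map_weierstrass to_ac E) P P = Infinity},
      monoid.mult = point_add (map_weierstrass to_ac E),
      one = Infinity\<rparr>"

text \<open>\<open>map_point \<sigma>\<close> is the coordinatewise Galois action on points.\<close>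

definition two_torsion_isomorphic :: "'a::field weierstrass \<Rightarrow> 'a weierstrass \<Rightarrow> bool" where
  "two_torsion_isomorphic E1 E2 \<longleftrightarrow>
     (\<exists>\<phi> \<in> iso (two_torsion E1) (two_torsion E2).
        \<forall>\<sigma> \<in> carrier abs_galois_group. \<forall>P \<in> carrier (two_torsion E1).
          \<phi> (map_point \<sigma> P) = map_point \<sigma> (\<phi> P))"


subsection \<open>The rational function $C$ and the two conditions\<close>

definition C_num :: "'a::field \<Rightarrow> 'a \<Rightarrow> 'a \<Rightarrow> 'a \<Rightarrow> 'a" where
  "C_num a b u v = (3 * a * v^2 + 9 * b * u * v - a^2 * u^2)^3"

definition index_form :: "'a::field \<Rightarrow> 'a \<Rightarrow> 'a \<Rightarrow> 'a \<Rightarrow> 'a" where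
  "index_form a b u v = v^3 + a * u^2 * v + b * u^3"

definition C_fun :: "'a::field \<Rightarrow> 'a \<Rightarrow> 'a \<Rightarrow> 'a \<Rightarrow> 'a" where
  "C_fun a b u v = C_num a b u v / (27 * a^3 * (index_form a b u v)^2)"

text \<open>\<open>Ca3_fun\<close> is the product $C(u,v) a^3$ with $a^3$ cancelled, so that it makes sense for
  $a = 0$ as well.\<close>

definition Ca3_fun :: "'a::field \<Rightarrow> 'a \<Rightarrow> 'a \<Rightarrow> 'a \<Rightarrow> 'a" where
  "Ca3_fun a b u v = C_num a b u v / (27 * (index_form a b u v)^2)"

lemma Ca3_fun_eq: "a \<noteq> 0 \<Longrightarrow> Ca3_fun a b u v = C_fun a b u v * a^3"
  by (simp add: Ca3_fun_def C_fun_def)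

text \<open>Both conditions are stated on homogeneous coordinates $(u,v)$ of a point of the projective
  line; they do not depend on the choice of coordinates.\<close>

lemma C_num_scale: "C_num a b (t * u) (t * v) = t^6 * C_num a b u v"
proof -
  have "3 * a * (t * v)^2 + 9 * b * (t * u) * (t * v) - a^2 * (t * u)^2
          = t^2 * (3 * a * v^2 + 9 * b * u * v - a^2 * u^2)"
    by (simp add: algebra_simps power2_eq_square)
  then show ?thesis by (simp add: C_num_def power_mult_distrib flip: power_mult)
qed

lemma index_form_scale: "index_form a b (t * u) (t * v) = t^3 * index_form a b u v"
  by (simp add: index_form_def algebra_simps power2_eq_square power3_eq_cube)

lemma C_fun_scale: "t \<noteq> 0 \<Longrightarrow> C_fun a b (t * u) (t * v) = C_fun a b u v"
  by (simp add: C_fun_def C_num_scale index_form_scale power_mult_distrib flip: power_mult)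

lemma Ca3_fun_scale: "t \<noteq> 0 \<Longrightarrow> Ca3_fun a b (t * u) (t * v) = Ca3_fun a b u v"
  by (simp add: Ca3_fun_def C_num_scale index_form_scale power_mult_distrib flip: power_mult)

definition condition_i :: "'a::field \<Rightarrow> 'a \<Rightarrow> 'a weierstrass \<Rightarrow> 'a \<Rightarrow> 'a \<Rightarrow> bool" where
  "condition_i a b E' u v \<longleftrightarrow> index_form a b u v \<noteq> 0 \<and>
     j_invariant E' / j_invariant (short_weierstrass a b) = C_fun a b u v"

definition condition_ii :: "'a::field \<Rightarrow> 'a \<Rightarrow> 'a weierstrass \<Rightarrow> 'a \<Rightarrow> 'a \<Rightarrow> bool" where
  "condition_ii a b E' u v \<longleftrightarrow> index_form a b u v \<noteq> 0 \<and>
     j_invariant E' / (j_invariant (short_weierstrass a b) - 1728)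
       = - 4 * Ca3_fun a b u v / (27 * b^2)"

end

theory Submission
  imports Defs
begin

text \<open>
  Two observations turn the statement into one about cubics. The nonzero $2$-torsion points of a
  curve correspond to the three roots of a cubic, and every bijection between the nonzero elements
  of two Klein four-groups is a group isomorphism. Hence $E'[2] \cong E[2]$ as Galois modules iff
  there is a Galois-equivariant bijection between the roots $s_i$ of $x^3 + A'x + B'$ (a reduced
  cubic of $E'$) and the roots $r_i$ of $x^3 + ax + b$ (\<open>two_torsion_isomorphic_iff\<close>).

  Such a bijection $r_i \mapsto s_i$ is interpolated by a unique polynomial
  $h(r) = ur^2 + vr + w$. By uniqueness Galois fixes its coefficients, so they lie in the base
  field, and $\sum s_i = 0$ forces $w = 2au/3$. Conversely, for $u, v$ in the base field, put
  $s_i = h(r_i)$ with this $w$. Then $s_i - s_j = (r_i - r_j)(v - ur_k)$ with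
  $\{i, j, k\} = \{1, 2, 3\}$, and $\prod_k (v - ur_k) = v^3 + au^2v + bu^3$. So $h$ is
  injective on the roots iff this form does not vanish, and the cubic with the roots $s_i$ has
  discriminant that of $x^3 + ax + b$ times the square of the form, and linear coefficient
  $(3av^2 + 9buv - a^2u^2)/3$
  (\<open>transform_split\<close>, \<open>transform_disc\<close>). Its $j$-invariant is therefore the one prescribed by each
  of the two conditions (\<open>condition_i_iff\<close>, \<open>condition_ii_iff\<close>). For the first half of the theorem
  it remains that two reduced cubics with the same $j \neq 0, 1728$ differ by a quadratic twist
  $(A, B) \mapsto (d^2 A, d^3 B)$, which scales the roots by $d$ and so preserves the Galois set
  of roots (\<open>twist_exists\<close>, \<open>equivariantly_bijective_twist\<close>).

  The interpolation argument uses that a separable element fixed by the absolute Galois group lies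
  in the base field (\<open>fixed_separable_in_base\<close>). For this one extends embeddings of subfields to the
  whole algebraic closure by Zorn's lemma (\<open>partial_embedding_extends\<close>), and restricts them to the
  separable closure. The restriction is an element of the Galois group only if the separable
  elements form a subring, which in positive characteristic $p$ follows from the fact that
  $z \in K(x)$ and $z^p \in K$ with $x$ separable over $K$ imply $z \in K$
  (\<open>separable_adjoin_purely_inseparable\<close>).
\<close>

section \<open>Partial embeddings of the algebraic closure over the base field\<close>

text \<open>
  A homomorphism over the base field from a subring of the algebraic closure into the closure,
  represented by its graph. A graph is a subring of the product of the closure with itself, so the
  union of a chain of homomorphisms is literally a union, and being single-valued is a condition at
  \<open>0\<close> alone.
\<close>

locale partial_embedding =
  fixes G :: "('a::field alg_closure \<times> 'a alg_closure) set"
  assumes const_mem: "(to_ac k, to_ac k) \<in> G"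
    and add_mem: "(a, b) \<in> G \<Longrightarrow> (c, d) \<in> G \<Longrightarrow> (a + c, b + d) \<in> G"
    and mult_mem: "(a, b) \<in> G \<Longrightarrow> (c, d) \<in> G \<Longrightarrow> (a * c, b * d) \<in> G"
    and zero_mem_imp: "(0, b) \<in> G \<Longrightarrow> b = 0"
begin

lemma zero_mem: "(0, 0) \<in> G" and one_mem: "(1, 1) \<in> G"
  using const_mem[of 0] const_mem[of 1] by auto

lemma minus_mem: "(a, b) \<in> G \<Longrightarrow> (- a, - b) \<in> G"
  using mult_mem[OF const_mem[of "- 1"], of a b] by simp

lemma diff_mem: "(a, b) \<in> G \<Longrightarrow> (c, d) \<in> G \<Longrightarrow> (a - c, b - d) \<in> G"
  using add_mem[of a b "- c" "- d"] minus_mem[of c d] by simp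

lemma single_valued: "(a, b) \<in> G \<Longrightarrow> (a, c) \<in> G \<Longrightarrow> b = c"
  using zero_mem_imp[of "b - c"] diff_mem[of a b a c] by simp

lemma sum_mem: "(\<And>i. i \<in> A \<Longrightarrow> (f i, g i) \<in> G) \<Longrightarrow> (sum f A, sum g A) \<in> G"
  by (induction A rule: infinite_finite_induct) (auto simp: zero_mem add_mem)

lemma power_mem: "(a, b) \<in> G \<Longrightarrow> (a ^ n, b ^ n) \<in> G"
  by (induction n) (auto simp: one_mem mult_mem)

text \<open>The coefficients of \<open>p\<close> lie in the domain of the embedding, and \<open>q\<close> is the image of \<open>p\<close>
  under its action on coefficients.\<close>

definition lifts :: "'a alg_closure poly \<Rightarrow> 'a alg_closure poly \<Rightarrow> bool" where
  "lifts p q \<longleftrightarrow> (\<forall>i. (coeff p i, coeff q i) \<in> G)"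

lemma lifts_add: "lifts p q \<Longrightarrow> lifts r s \<Longrightarrow> lifts (p + r) (q + s)"
  by (simp add: lifts_def add_mem)

lemma lifts_diff: "lifts p q \<Longrightarrow> lifts r s \<Longrightarrow> lifts (p - r) (q - s)"
  by (simp add: lifts_def diff_mem)

lemma lifts_mult: "lifts p q \<Longrightarrow> lifts r s \<Longrightarrow> lifts (p * r) (q * s)"
  by (auto simp: lifts_def coeff_mult intro!: sum_mem mult_mem)

lemma lifts_monom: "(a, b) \<in> G \<Longrightarrow> lifts (monom a n) (monom b n)"
  by (simp add: lifts_def zero_mem)

lemma lifts_const: "(a, b) \<in> G \<Longrightarrow> lifts [:a:] [:b:]"
  using lifts_monom[of a b 0] by (simp add: monom_0)

lemma lifts_X: "lifts [:0, 1:] [:0, 1:]"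
  by (simp add: lifts_def zero_mem one_mem coeff_pCons split: nat.split)

lemma lifts_base: "lifts (map_poly to_ac p) (map_poly to_ac p)"
  by (simp add: lifts_def coeff_map_poly const_mem)

lemma lifts_power: "lifts p q \<Longrightarrow> lifts (p ^ n) (q ^ n)"
proof (induction n)
  case 0 then show ?case using lifts_const[OF one_mem] by (simp add: one_pCons)
qed (simp add: lifts_mult)

lemma lifts_pderiv: assumes "lifts p q" shows "lifts (pderiv p) (pderiv q)"
proof -
  have "(of_nat n, of_nat n) \<in> G" for n :: nat
    using const_mem[of "of_nat n"] by simp
  then show ?thesis using assms by (metis lifts_def coeff_pderiv mult_mem)
qed

lemma lifts_poly_mem:
  assumes "lifts p q" "(x, y) \<in> G"
  shows "(poly p x, poly q y) \<in> G"
proof -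
  define n where "n = max (degree p) (degree q)"
  have "poly p x = (\<Sum>i\<le>n. coeff p i * x ^ i)" "poly q y = (\<Sum>i\<le>n. coeff q i * y ^ i)"
    by (auto simp: poly_altdef n_def coeff_eq_0 intro!: sum.mono_neutral_left le_degree)
  with assms show ?thesis by (simp add: lifts_def sum_mem mult_mem power_mem)
qed

lemma lifts_zero_imp: "lifts 0 s \<Longrightarrow> s = 0"
  by (auto simp: lifts_def poly_eq_iff intro: zero_mem_imp)

text \<open>The element \<open>a\<close> is algebraic over the base field, so its inverse is a polynomial in \<open>a\<close>
  over the base field. Thus the domain, although only required to be a subring, is a field.\<close>

lemma inverse_mem:
  assumes ab: "(a, b) \<in> G" and "a \<noteq> 0"
  shows "(inverse a, inverse b) \<in> G"
proof -
  \<comment> \<open>Divide an annihilating polynomial by powers of the variable until its constant term \<open>c\<close>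
    is nonzero; then \<open>c\<close> is \<open>a\<close> times a polynomial in \<open>a\<close>.\<close>
  have "\<exists>r. a * poly (map_poly to_ac r) a = 1"
    if "poly (map_poly to_ac p) a = 0" "p \<noteq> 0" for p :: "'a poly"
    using that
  proof (induction p)
    case (pCons c p)
    show ?case
    proof (cases "c = 0")
      case True
      with pCons \<open>a \<noteq> 0\<close> show ?thesis by (auto simp: map_poly_pCons)
    next
      case False
      have eq: "a * poly (map_poly to_ac p) a = - to_ac c"
        using pCons.prems by (simp add: map_poly_pCons eq_neg_iff_add_eq_0 add.commute)
      define r where "r = smult (- inverse c) p"
      have "map_poly to_ac r = smult (- inverse (to_ac c)) (map_poly to_ac p)"
        by (rule poly_eqI) (simp add: r_def coeff_map_poly)
      then have "a * poly (map_poly to_ac r) a = - inverse (to_ac c) * (a * poly (map_poly to_ac p) a)"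
        by simp
      also have "\<dots> = 1" using False by (simp add: eq)
      finally show ?thesis by blast
    qed
  qed auto
  then obtain r where r: "a * poly (map_poly to_ac r) a = 1"
    by (metis alg_closure_algebraic)
  define b' where "b' = poly (map_poly to_ac r) b"
  have mem: "(poly (map_poly to_ac r) a, b') \<in> G"
    unfolding b'_def by (rule lifts_poly_mem[OF lifts_base ab])
  have "b * b' = 1"
    using single_valued[OF mult_mem[OF ab mem]] r one_mem by auto
  then have "inverse b = b'" by (metis inverse_unique)
  moreover have "inverse a = poly (map_poly to_ac r) a" using r by (metis inverse_unique)
  ultimately show ?thesis using mem by simp
qed

lemma mem_zero_imp:
  assumes "(a, 0) \<in> G"
  shows "a = 0"
proof (rule ccontr)
  assume "a \<noteq> 0"
  with mult_mem[OF assms inverse_mem[OF assms this]] have "(1, 0) \<in> G" by simp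
  then show False using single_valued one_mem by fastforce
qed

lemma lifts_degree: "lifts p q \<Longrightarrow> degree q = degree p"
  unfolding lifts_def degree_def
  by (rule arg_cong[where f = Least]) (metis mem_zero_imp zero_mem_imp)

section \<open>Minimal polynomials over the domain of a partial embedding\<close>

text \<open>Long division by a monic polynomial only uses ring operations on coefficients, so it can be
  carried out over the domain and its image simultaneously.\<close>

lemma lifts_division:
  assumes pq: "lifts p q" and monic: "lead_coeff p = 1" and "lifts f g"
  shows "\<exists>k l r s. lifts k l \<and> lifts r s \<and> f = p * k + r \<and> g = q * l + s \<and>
           (r = 0 \<or> degree r < degree p)"
  using \<open>lifts f g\<close>
proof (induction "degree f" arbitrary: f g rule: less_induct)
  case less
  have zero: "lifts 0 0" using lifts_const[OF zero_mem] by simp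
  show ?case
  proof (cases "f = 0 \<or> degree f < degree p")
    case True
    then show ?thesis using less.prems zero
      by (intro exI[of _ 0] exI[of _ f] exI[of _ g]) auto
  next
    case False
    then have f: "f \<noteq> 0" "degree p \<le> degree f" by auto
    define n where "n = degree f - degree p"
    define k where "k = monom (lead_coeff f) n"
    define l where "l = monom (lead_coeff g) n"
    have kl: "lifts k l"
      unfolding k_def l_def using less.prems by (metis lifts_def lifts_degree lifts_monom)
    have p0: "p \<noteq> 0" using monic by auto
    have k0: "k \<noteq> 0" using f by (simp add: k_def)
    have deg: "degree (p * k) = degree f"
      using f p0 k0 by (simp add: degree_mult_eq k_def n_def degree_monom_eq)
    have lead: "lead_coeff (p * k) = lead_coeff f"
      using monic f by (simp add: lead_coeff_mult k_def degree_monom_eq)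
    define f' where "f' = f - p * k"
    define g' where "g' = g - q * l"
    have fg': "lifts f' g'"
      unfolding f'_def g'_def using less.prems pq kl by (simp add: lifts_diff lifts_mult)
    have "f' = 0 \<or> degree f' < degree f"
    proof (cases "degree f = 0")
      case True
      then have "degree f' = 0"
        using degree_diff_le[of f 0 "p * k"] deg by (simp add: f'_def)
      moreover have "coeff f' 0 = 0" using lead deg True by (simp add: f'_def)
      ultimately show ?thesis by (metis leading_coeff_0_iff)
    next
      case False
      have "degree f' \<le> degree f" unfolding f'_def using deg by (intro degree_diff_le) auto
      moreover have "coeff f' (degree f) = 0" using lead deg by (simp add: f'_def)
      ultimately show ?thesis by (metis leading_coeff_0_iff le_neq_implies_less)
    qed
    then have "\<exists>k l r s. lifts k l \<and> lifts r s \<and> f' = p * k + r \<and> g' = q * l + s \<and>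
           (r = 0 \<or> degree r < degree p)"
    proof
      assume "f' = 0"
      then show ?thesis using fg' lifts_zero_imp zero
        by (intro exI[of _ 0]) auto
    qed (use less.hyps fg' in blast)
    then obtain k' l' r s where "lifts k' l'" "lifts r s" "f' = p * k' + r" "g' = q * l' + s"
           "r = 0 \<or> degree r < degree p" by blast
    then show ?thesis using kl
      by (intro exI[of _ "k + k'"] exI[of _ "l + l'"] exI[of _ r] exI[of _ s])
         (auto simp: lifts_add f'_def g'_def algebra_simps)
  qed
qed

text \<open>Here \<open>p\<close> is the minimal polynomial of \<open>x\<close> over the domain of the embedding, and \<open>q\<close> is its
  image, whose roots are the possible values of an extension at \<open>x\<close>.\<close>

definition minimal_lift :: "'a alg_closure \<Rightarrow> 'a alg_closure poly \<Rightarrow> 'a alg_closure poly \<Rightarrow> bool" where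
  "minimal_lift x p q \<longleftrightarrow> lifts p q \<and> lead_coeff p = 1 \<and> poly p x = 0 \<and>
     (\<forall>r s. lifts r s \<longrightarrow> r \<noteq> 0 \<longrightarrow> poly r x = 0 \<longrightarrow> degree p \<le> degree r)"

lemma minimal_lift_exists: "\<exists>p q. minimal_lift x p q"
proof -
  let ?P = "\<lambda>n. \<exists>r s. lifts r s \<and> r \<noteq> 0 \<and> poly r x = 0 \<and> degree r = n"
  obtain f :: "'a poly" where "f \<noteq> 0" "poly (map_poly to_ac f) x = 0"
    by (rule alg_closure_algebraic)
  then have "?P (degree (map_poly to_ac f))"
    using lifts_base[of f] by (metis map_poly_eq_0_iff to_ac_0 to_ac_eq_0_iff)
  then have "?P (Least ?P)" by (rule LeastI)
  then obtain r s where rs: "lifts r s" "r \<noteq> 0" "poly r x = 0" "degree r = Least ?P" by blast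
  define c where "c = inverse (lead_coeff r)"
  define d where "d = inverse (lead_coeff s)"
  have c: "c \<noteq> 0" using rs(2) by (simp add: c_def)
  have "(c, d) \<in> G"
    unfolding c_def d_def using rs by (metis inverse_mem leading_coeff_0_iff lifts_def lifts_degree)
  then have "lifts (smult c r) (smult d s)"
    using lifts_mult[OF lifts_const[of c d] rs(1)] by simp
  moreover have "lead_coeff (smult c r) = 1" using rs(2) by (simp add: c_def)
  moreover have "degree (smult c r) \<le> degree r'" if "lifts r' s'" "r' \<noteq> 0" "poly r' x = 0" for r' s'
  proof -
    have "Least ?P \<le> degree r'" using that by (intro Least_le) blast
    then show ?thesis using rs(4) c by simp
  qed
  ultimately show ?thesis unfolding minimal_lift_def using rs(3) by (metis poly_smult mult_zero_right)
qed

lemma minimal_lift_dvd: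
  assumes m: "minimal_lift x p q" and "lifts r s" "poly r x = 0"
  obtains k l where "lifts k l" "r = p * k" "s = q * l"
proof -
  from m have "lifts p q" "lead_coeff p = 1" "poly p x = 0" by (auto simp: minimal_lift_def)
  from lifts_division[OF this(1,2) \<open>lifts r s\<close>] this(3)
  obtain k l r' s' where *: "lifts k l" "lifts r' s'" "r = p * k + r'" "s = q * l + s'"
    "r' = 0 \<or> degree r' < degree p" by blast
  have "poly r' x = 0" using * \<open>poly p x = 0\<close> \<open>poly r x = 0\<close> by simp
  then have "r' = 0" using m * unfolding minimal_lift_def by fastforce
  then show ?thesis using * lifts_zero_imp that by auto
qed

lemma minimal_lift_degree_pos: "minimal_lift x p q \<Longrightarrow> degree p > 0"
  unfolding minimal_lift_def by (metis degree_eq_zeroE gr0I lead_coeff_pCons(2) poly_const_conv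
      zero_neq_one)

text \<open>The graph of the extension of the embedding to the ring generated by \<open>x\<close> that sends \<open>x\<close> to
  \<open>y\<close>. It is a graph when \<open>y\<close> is a root of the image of the minimal polynomial of \<open>x\<close>.\<close>

definition adjoin :: "'a alg_closure \<Rightarrow> 'a alg_closure \<Rightarrow> ('a alg_closure \<times> 'a alg_closure) set" where
  "adjoin x y = {(poly r x, poly s y) | r s. lifts r s}"

lemma adjoin_supset: "G \<subseteq> adjoin x y"
proof clarify
  fix a b assume "(a, b) \<in> G"
  then show "(a, b) \<in> adjoin x y"
    unfolding adjoin_def using lifts_const[of a b]
    by (intro CollectI exI[of _ "[:a:]"] exI[of _ "[:b:]"]) auto
qed

lemma adjoin_gen: "(x, y) \<in> adjoin x y"
  unfolding adjoin_def using lifts_X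
  by (intro CollectI exI[of _ "[:0,1:]"]) auto

text \<open>A polynomial that vanishes at \<open>x\<close> is a multiple of the minimal polynomial, so its image
  vanishes at \<open>y\<close>; this is single-valuedness at \<open>0\<close>.\<close>

lemma adjoin_partial_embedding:
  assumes m: "minimal_lift x p q" and y: "poly q y = 0"
  shows "partial_embedding (adjoin x y)"
proof
  show "(to_ac c, to_ac c) \<in> adjoin x y" for c using adjoin_supset const_mem by blast
next
  fix a b c d assume "(a, b) \<in> adjoin x y" "(c, d) \<in> adjoin x y"
  then obtain r s r' s' where *: "lifts r s" "lifts r' s'" "a = poly r x" "b = poly s y"
    "c = poly r' x" "d = poly s' y" by (auto simp: adjoin_def)
  show "(a + c, b + d) \<in> adjoin x y"
    unfolding adjoin_def using * lifts_add[OF *(1,2)]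
    by (intro CollectI exI[of _ "r + r'"] exI[of _ "s + s'"]) simp
  show "(a * c, b * d) \<in> adjoin x y"
    unfolding adjoin_def using * lifts_mult[OF *(1,2)]
    by (intro CollectI exI[of _ "r * r'"] exI[of _ "s * s'"]) simp
next
  fix b assume "(0, b) \<in> adjoin x y"
  then obtain r s where "lifts r s" "poly r x = 0" "b = poly s y" by (auto simp: adjoin_def)
  then show "b = 0" using minimal_lift_dvd[OF m] y by (metis mult_zero_left poly_mult)
qed

end

section \<open>Endomorphisms of the algebraic closure over the base field\<close>

lemma partial_embedding_Union:
  assumes "C \<noteq> {}" and ch: "subset.chain A C" and A: "\<And>G. G \<in> A \<Longrightarrow> partial_embedding G"
  shows "partial_embedding (\<Union>C)"
proof -
  have C: "G \<in> C \<Longrightarrow> partial_embedding G" for G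
    using ch A by (auto simp: subset.chain_def)
  have common: "\<exists>G\<in>C. P \<in> G \<and> Q \<in> G" if "P \<in> \<Union>C" "Q \<in> \<Union>C" for P Q

  proof -
    from that obtain G H where GH: "G \<in> C" "P \<in> G" "H \<in> C" "Q \<in> H" by blast
    have "G \<subseteq> H \<or> H \<subseteq> G" using ch GH by (meson subset_chain_def)
    with GH show ?thesis by blast
  qed
  show ?thesis
  proof
    show "(to_ac c, to_ac c) \<in> \<Union>C" for c
      using C partial_embedding.const_mem \<open>C \<noteq> {}\<close> by fastforce
  next
    fix a b c d assume "(a, b) \<in> \<Union>C" "(c, d) \<in> \<Union>C"
    then obtain G where "G \<in> C" "(a, b) \<in> G" "(c, d) \<in> G" using common by metis
    then show "(a + c, b + d) \<in> \<Union>C" "(a * c, b * d) \<in> \<Union>C"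
      using C partial_embedding.add_mem partial_embedding.mult_mem by fast+
  next
    show "b = 0" if "(0, b) \<in> \<Union>C" for b
      using that C partial_embedding.zero_mem_imp by blast
  qed
qed

definition base_hom :: "('a::field alg_closure \<Rightarrow> 'a alg_closure) \<Rightarrow> bool" where
  "base_hom \<tau> \<longleftrightarrow> (\<forall>x y. \<tau> (x + y) = \<tau> x + \<tau> y) \<and> (\<forall>x y. \<tau> (x * y) = \<tau> x * \<tau> y) \<and>
     (\<forall>c. \<tau> (to_ac c) = to_ac c)"

text \<open>A maximal partial embedding is defined everywhere: the minimal polynomial of any \<open>x\<close> over its
  domain has an image with a root \<open>y\<close>, because the closure is algebraically closed, and adjoining
  the pair \<open>(x, y)\<close> cannot enlarge the graph.\<close>

lemma partial_embedding_extends: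
  assumes "partial_embedding G"
  obtains \<tau> where "base_hom \<tau>" "\<And>x y. (x, y) \<in> G \<Longrightarrow> \<tau> x = y"
proof -
  define A where "A = {H. partial_embedding H \<and> G \<subseteq> H}"
  have "\<exists>M\<in>A. \<forall>H\<in>A. M \<subseteq> H \<longrightarrow> H = M"
  proof (rule subset_Zorn_nonempty)
    show "A \<noteq> {}" using assms by (auto simp: A_def)
    fix C assume C: "C \<noteq> {}" "subset.chain A C"
    then have "partial_embedding (\<Union>C)" by (intro partial_embedding_Union) (auto simp: A_def)
    moreover have "G \<subseteq> \<Union>C" using C by (fastforce simp: subset_chain_def A_def)
    ultimately show "\<Union>C \<in> A" by (simp add: A_def)
  qed
  then obtain M where M: "partial_embedding M" "G \<subseteq> M"
    and max: "\<And>H. partial_embedding H \<Longrightarrow> M \<subseteq> H \<Longrightarrow> H = M"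
    unfolding A_def by (metis (mono_tags, lifting) mem_Collect_eq subset_trans)
  interpret M: partial_embedding M by fact
  have total: "\<exists>y. (x, y) \<in> M" for x
  proof -
    obtain p q where m: "M.minimal_lift x p q" using M.minimal_lift_exists by blast
    have "degree q > 0"
      using M.minimal_lift_degree_pos[OF m] m by (metis M.lifts_degree M.minimal_lift_def)
    then obtain y where "poly q y = 0" using alg_closed_imp_poly_has_root by blast
    from max[OF M.adjoin_partial_embedding[OF m this] M.adjoin_supset]
    show ?thesis using M.adjoin_gen by blast
  qed
  define \<tau> where "\<tau> = (\<lambda>x. THE y. (x, y) \<in> M)"
  have \<tau>: "\<tau> x = y" if "(x, y) \<in> M" for x y
    unfolding \<tau>_def using that M.single_valued by blast
  have mem: "(x, \<tau> x) \<in> M" for x using total \<tau> by blast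
  show ?thesis
  proof
    show "base_hom \<tau>"
      unfolding base_hom_def using mem M.add_mem M.mult_mem M.const_mem by (auto intro!: \<tau>)
    show "\<tau> x = y" if "(x, y) \<in> G" for x y using that M(2) \<tau> by blast
  qed
qed

lemma map_poly_to_ac_mult: "map_poly to_ac (p * q) = map_poly to_ac p * map_poly to_ac q"
  by (rule poly_eqI) (simp add: coeff_map_poly coeff_mult to_ac_sum)

lemma pderiv_map_poly_to_ac: "pderiv (map_poly to_ac p) = map_poly to_ac (pderiv p)"
proof (rule poly_eqI)
  fix n
  have "to_ac (of_nat (Suc n)) = of_nat (Suc n)" by (rule to_ac_of_nat)
  then show "coeff (pderiv (map_poly to_ac p)) n = coeff (map_poly to_ac (pderiv p)) n"
    by (simp add: coeff_map_poly coeff_pderiv del: of_nat_Suc)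
qed

lemma degree_map_poly_to_ac [simp]: "degree (map_poly to_ac p) = degree p"
  by (cases "p = 0") (auto intro!: map_poly_degree_eq)

lemma map_poly_to_ac_eq_iff: "map_poly to_ac p = map_poly to_ac q \<longleftrightarrow> p = q"
  by (auto simp: poly_eq_iff coeff_map_poly)

context
  fixes \<tau> :: "'a::field alg_closure \<Rightarrow> 'a alg_closure"
  assumes \<tau>: "base_hom \<tau>"
begin

lemma base_hom_add: "\<tau> (x + y) = \<tau> x + \<tau> y"
  and base_hom_mult: "\<tau> (x * y) = \<tau> x * \<tau> y"
  and base_hom_const: "\<tau> (to_ac c) = to_ac c"
  using \<tau> by (auto simp: base_hom_def)

lemma base_hom_0: "\<tau> 0 = 0" and base_hom_1: "\<tau> 1 = 1"
  using base_hom_const[of 0] base_hom_const[of 1] by auto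

lemma base_hom_eq_0_iff: "\<tau> x = 0 \<longleftrightarrow> x = 0"
proof
  assume "\<tau> x = 0"
  then have "\<tau> (x * inverse x) = 0" by (simp add: base_hom_mult)
  then show "x = 0" using base_hom_1 by (metis right_inverse zero_neq_one)
qed (simp add: base_hom_0)

lemma base_hom_diff: "\<tau> (x - y) = \<tau> x - \<tau> y"
  by (metis add_diff_cancel base_hom_add diff_add_cancel)

lemma base_hom_inj: "inj \<tau>"
  by (rule injI) (metis base_hom_diff base_hom_eq_0_iff right_minus_eq)

lemma base_hom_poly: "\<tau> (poly (map_poly to_ac p) x) = poly (map_poly to_ac p) (\<tau> x)"
  by (induction p) (auto simp: map_poly_pCons base_hom_0 base_hom_add base_hom_mult base_hom_const)

text \<open>An injective self-map of a finite set is a permutation. As every element is a root of a base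
  polynomial, this is where surjectivity of endomorphisms over the base field comes from.\<close>

lemma base_hom_permutes_roots:
  assumes "p \<noteq> 0"
  shows "bij_betw \<tau> {x. poly (map_poly to_ac p) x = 0} {x. poly (map_poly to_ac p) x = 0}"
proof -
  let ?R = "{x. poly (map_poly to_ac p) x = 0}"
  have "map_poly to_ac p \<noteq> 0" using assms by (metis map_poly_eq_0_iff to_ac_0 to_ac_eq_0_iff)
  then have fin: "finite ?R" by (rule poly_roots_finite)
  have sub: "\<tau> ` ?R \<subseteq> ?R" by (auto simp: base_hom_0 simp flip: base_hom_poly)
  have inj: "inj_on \<tau> ?R" using base_hom_inj by (rule inj_on_subset) simp
  then show ?thesis using endo_inj_surj[OF fin sub] by (simp add: bij_betw_def)
qed

end

section \<open>Subrings containing the base field\<close>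

definition base_subring :: "'a::field alg_closure set \<Rightarrow> bool" where
  "base_subring K \<longleftrightarrow> range to_ac \<subseteq> K \<and> (\<forall>a\<in>K. \<forall>b\<in>K. a + b \<in> K \<and> a * b \<in> K)"

text \<open>The identity of a subring is a partial embedding, so the results on minimal polynomials and
  their images yield those on minimal polynomials over the subring.\<close>

lemma partial_embedding_Id_on: "base_subring K \<Longrightarrow> partial_embedding (Id_on K)"
  by unfold_locales (auto simp: base_subring_def)

lemma base_subring_range: "base_subring (range to_ac)"
  unfolding base_subring_def by (auto simp flip: to_ac_add to_ac_mult)

lemma lifts_Id_on:
  assumes "base_subring K"
  shows "partial_embedding.lifts (Id_on K) p q \<longleftrightarrow> p = q \<and> (\<forall>i. coeff p i \<in> K)"
proof -
  interpret partial_embedding "Id_on K" by (rule partial_embedding_Id_on[OF assms])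
  show ?thesis by (auto simp: lifts_def Id_on_iff poly_eq_iff)
qed

lemma coeffs_in_range_to_ac:
  assumes "\<And>i. coeff p i \<in> range to_ac"
  obtains q where "p = map_poly to_ac q"
proof
  show "p = map_poly to_ac (map_poly of_ac p)"
    using assms by (intro poly_eqI) (simp add: coeff_map_poly to_ac_of_ac)
qed

lemma lifts_range_to_ac:
  "partial_embedding.lifts (Id_on (range to_ac)) p q \<longleftrightarrow> p = q \<and> (\<exists>r. p = map_poly to_ac r)"
  unfolding lifts_Id_on[OF base_subring_range]
  by (auto simp: coeff_map_poly) (metis coeffs_in_range_to_ac)

definition ring_adjoin :: "'a::field alg_closure set \<Rightarrow> 'a alg_closure \<Rightarrow> 'a alg_closure set" where
  "ring_adjoin K x = {poly p x | p. \<forall>i. coeff p i \<in> K}"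

lemma ring_adjoin_iff:
  "base_subring K \<Longrightarrow> z \<in> ring_adjoin K x \<longleftrightarrow> (z, z) \<in> partial_embedding.adjoin (Id_on K) x x"
  by (auto simp: ring_adjoin_def partial_embedding.adjoin_def partial_embedding_Id_on lifts_Id_on)

text \<open>The ring generated by \<open>x\<close> over \<open>K\<close> is the domain of the extension of the identity that fixes
  \<open>x\<close>.\<close>

lemma base_subring_adjoin:
  assumes K: "base_subring K"
  shows "base_subring (ring_adjoin K x)"
proof -
  interpret partial_embedding "Id_on K" by (rule partial_embedding_Id_on[OF K])
  obtain p q where m: "minimal_lift x p q" using minimal_lift_exists by blast
  then have "q = p" "poly p x = 0"
    unfolding minimal_lift_def using lifts_Id_on[OF K] by auto
  then interpret A: partial_embedding "adjoin x x" using adjoin_partial_embedding[OF m] by simp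
  show ?thesis
    unfolding base_subring_def using ring_adjoin_iff[OF K] A.const_mem A.add_mem A.mult_mem by blast
qed

lemma ring_adjoin_supset: "base_subring K \<Longrightarrow> K \<subseteq> ring_adjoin K x"
  using partial_embedding.adjoin_supset[OF partial_embedding_Id_on] ring_adjoin_iff by fast

lemma ring_adjoin_gen: "base_subring K \<Longrightarrow> x \<in> ring_adjoin K x"
  using partial_embedding.adjoin_gen[OF partial_embedding_Id_on] ring_adjoin_iff by fast

lemma ring_adjoin_mono: "K \<subseteq> L \<Longrightarrow> ring_adjoin K x \<subseteq> ring_adjoin L x"
  unfolding ring_adjoin_def by blast

section \<open>Separable elements form a field\<close>

context partial_embedding
begin

lemma minimal_lift_simple_root:
  assumes m: "minimal_lift x p q" and "lifts f g" "poly f x = 0" "poly (pderiv f) x \<noteq> 0"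
  shows "poly (pderiv p) x \<noteq> 0"
proof -
  obtain k l where "f = p * k" using minimal_lift_dvd[OF assms(1-3)] by blast
  moreover have "poly p x = 0" using m by (simp add: minimal_lift_def)
  ultimately show ?thesis using assms(4) by (auto simp: pderiv_mult)
qed

text \<open>The embedding that sends \<open>x\<close> to its conjugate \<open>y\<close> also sends the derivative of \<open>p\<close> at \<open>x\<close>
  to the derivative of \<open>q\<close> at \<open>y\<close>, and embeddings are injective.\<close>

lemma minimal_lift_simple_conjugates:
  assumes m: "minimal_lift x p q" and "poly (pderiv p) x \<noteq> 0" and y: "poly q y = 0"
  shows "poly (pderiv q) y \<noteq> 0"
proof -
  interpret A: partial_embedding "adjoin x y" by (rule adjoin_partial_embedding[OF m y])
  have "lifts p q" using m by (simp add: minimal_lift_def)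
  then have "(poly (pderiv p) x, poly (pderiv q) y) \<in> adjoin x y"
    unfolding adjoin_def using lifts_pderiv by blast
  then show ?thesis using A.mem_zero_imp assms(2) by metis
qed

end

lemma card_roots_eq_degree:
  fixes p :: "'k::alg_closed_field poly"
  assumes "p \<noteq> 0" and simple: "\<And>x. poly p x = 0 \<Longrightarrow> poly (pderiv p) x \<noteq> 0"
  shows "card {x. poly p x = 0} = degree p"
proof -
  obtain A where A: "size A = degree p" "p = smult (lead_coeff p) (\<Prod>x\<in>#A. [:- x, 1:])"
    using alg_closed_imp_factorization[OF \<open>p \<noteq> 0\<close>] by blast
  have p_eq: "p = smult (lead_coeff p) ([:- x, 1:] * (\<Prod>y\<in>#A - {#x#}. [:- y, 1:]))"
    if "x \<in># A" for x
    by (subst A(2), subst (1) insert_DiffM[OF that, symmetric]) (simp only: image_mset_add_mset prod_mset.add_mset)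
  have "count A x = 1" if "x \<in># A" for x
  proof (rule ccontr)
    assume "count A x \<noteq> 1"
    then have "x \<in># A - {#x#}" using that by (simp add: not_in_iff flip: count_greater_zero_iff)
    then have "(\<Prod>y\<in>#A - {#x#}. [:- y, 1:]) = [:- x, 1:] * (\<Prod>y\<in>#A - {#x#} - {#x#}. [:- y, 1:])"
      by (metis (no_types, lifting) image_mset_add_mset insert_DiffM prod_mset.add_mset)
    with p_eq[OF that] obtain q where q: "p = smult (lead_coeff p) ([:- x, 1:] * ([:- x, 1:] * q))"
      by metis
    have "poly p x = 0" by (subst q) simp
    moreover have "poly (pderiv p) x = 0"
      by (subst q) (simp only: pderiv_smult pderiv_mult, simp)
    ultimately show False using simple by blast
  qed
  then have "card (set_mset A) = size A"
    by (simp add: size_multiset_overloaded_eq)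
  moreover have "{x. poly p x = 0} = set_mset A"
    by (subst A(2)) (use \<open>p \<noteq> 0\<close> in \<open>auto simp: poly_prod_mset prod_mset_zero_iff\<close>)
  ultimately show ?thesis using A(1) by simp
qed

text \<open>
  Write $z = q(x)$ with $q$ of degree less than that of the minimal polynomial $m$ of $x$ over $K$.
  The polynomial $q^p - z^p$ has coefficients in $K$ and vanishes at $x$, so it is divisible by $m$
  and $q(y)^p = z^p$ for every root $y$ of $m$. By injectivity of Frobenius $q$ takes the value $z$
  at all roots of $m$. These are $\deg m$ many, because $m$ has a simple root and hence only
  simple roots. Therefore $q$ is the constant $z$, and its coefficients lie in $K$.
\<close>

lemma separable_adjoin_purely_inseparable:
  fixes x z :: "'a::field alg_closure"
  assumes char: "CHAR('a) > 0" and K: "base_subring K"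
    and f: "\<And>i. coeff f i \<in> K" "poly f x = 0" "poly (pderiv f) x \<noteq> 0"
    and z: "z \<in> ring_adjoin K x" "z ^ CHAR('a) \<in> K"
  shows "z \<in> K"
proof -
  interpret partial_embedding "Id_on K" by (rule partial_embedding_Id_on[OF K])
  note L = lifts_Id_on[OF K]
  let ?c = "CHAR('a)"
  have prime: "prime CHAR('a alg_closure)" using char prime_CHAR_semidom[where ?'a = 'a] by simp
  have frobenius: "w ^ ?c = w' ^ ?c \<Longrightarrow> w = w'" for w w' :: "'a alg_closure"
    using freshmans_dream[OF prime refl, of "w - w'" w'] by simp
  obtain m where m: "minimal_lift x m m"
    using minimal_lift_exists L unfolding minimal_lift_def by metis
  have m': "lifts m m" "lead_coeff m = 1" "poly m x = 0" using m by (auto simp: minimal_lift_def)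
  have simple: "poly (pderiv m) y \<noteq> 0" if "poly m y = 0" for y
    using minimal_lift_simple_conjugates[OF m minimal_lift_simple_root[OF m _ f(2,3)] that] L f(1)
    by blast
  obtain q0 where q0: "\<forall>i. coeff q0 i \<in> K" "z = poly q0 x" using z by (auto simp: ring_adjoin_def)
  obtain k q where q: "lifts q q" "q0 = m * k + q" "q = 0 \<or> degree q < degree m"
    using lifts_division[OF m'(1,2), of q0 q0] q0 L by auto
  have qx: "poly q x = z" using q q0 m' by simp
  define h where "h = q ^ ?c - [:z ^ ?c:]"
  have "lifts h h"
    unfolding h_def using q(1) z(2) by (intro lifts_diff lifts_power lifts_const) auto
  moreover have "poly h x = 0" by (simp add: h_def poly_power qx)
  ultimately obtain l where l: "h = m * l" using minimal_lift_dvd[OF m] by metis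
  have "poly q y = z" if "poly m y = 0" for y
  proof -
    have "poly h y = 0" using l that by simp
    then have "poly q y ^ ?c = z ^ ?c" by (simp add: h_def)
    then show ?thesis by (rule frobenius)
  qed
  then have sub: "{y. poly m y = 0} \<subseteq> {y. poly (q - [:z:]) y = 0}" by auto
  have "q - [:z:] = 0"
  proof (rule ccontr)
    assume nz: "q - [:z:] \<noteq> 0"
    have "degree m = card {y. poly m y = 0}"
      using card_roots_eq_degree[of m] simple m' by fastforce
    also have "\<dots> \<le> card {y. poly (q - [:z:]) y = 0}"
      by (rule card_mono[OF poly_roots_finite[OF nz] sub])
    also have "\<dots> \<le> degree (q - [:z:])" by (rule card_poly_roots_bound[OF nz])
    also have "\<dots> \<le> degree q" by (intro degree_diff_le) auto
    finally have "degree m \<le> degree q" .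
    with q(3) have "q = 0" by auto
    with \<open>degree m \<le> degree q\<close> minimal_lift_degree_pos[OF m] show False by simp
  qed
  then have "coeff q 0 = z" by simp
  then show ?thesis using q(1) L by metis
qed

text \<open>Being a simple root of some polynomial is equivalent to having a separable minimal polynomial
  (\<open>sep_closure_iff_separable\<close>), but can be checked on any convenient polynomial and persists when
  the base is enlarged.\<close>

definition separable :: "'a::field alg_closure \<Rightarrow> bool" where
  "separable x \<longleftrightarrow> (\<exists>f::'a poly. poly (map_poly to_ac f) x = 0 \<and> poly (map_poly to_ac (pderiv f)) x \<noteq> 0)"

text \<open>The minimal lift for the identity of the base field is the image of an irreducible polynomial
  over the base field, because a proper factor vanishing at \<open>x\<close> would have smaller degree.\<close>

lemma minimal_polynomial:
  fixes x :: "'a::field alg_closure"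
  obtains m :: "'a poly" where "Factorial_Ring.irreducible m"
    "partial_embedding.minimal_lift (Id_on (range to_ac)) x (map_poly to_ac m) (map_poly to_ac m)"
proof -
  interpret partial_embedding "Id_on (range to_ac)"
    by (rule partial_embedding_Id_on[OF base_subring_range])
  obtain p q where pq: "minimal_lift x p q" using minimal_lift_exists by blast
  then obtain m :: "'a poly" where m: "p = map_poly to_ac m" "q = map_poly to_ac m"
    unfolding minimal_lift_def lifts_range_to_ac by blast
  have deg: "degree m > 0" using minimal_lift_degree_pos[OF pq] m by simp
  have root: "poly (map_poly to_ac m) x = 0" using pq m by (simp add: minimal_lift_def)
  have least: "degree m \<le> degree r" if "r \<noteq> 0" "poly (map_poly to_ac r) x = 0" for r
  proof -
    have "map_poly to_ac r \<noteq> 0" using that map_poly_to_ac_eq_iff[of r 0] by simp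
    then show ?thesis
      using pq that m unfolding minimal_lift_def lifts_range_to_ac
      by (metis degree_map_poly_to_ac)
  qed
  have "Factorial_Ring.irreducible m"
  proof (rule Factorial_Ring.irreducibleI)
    show "m \<noteq> 0" using deg by auto
    then show "\<not> m dvd 1" using deg by (simp add: is_unit_iff_degree)
    fix a b assume ab: "m = a * b"
    then have nz: "a \<noteq> 0" "b \<noteq> 0" using deg by auto
    then have "degree m = degree a + degree b" using ab by (simp add: degree_mult_eq)
    moreover have "poly (map_poly to_ac a) x = 0 \<or> poly (map_poly to_ac b) x = 0"
      using root by (simp add: ab map_poly_to_ac_mult)
    ultimately have "degree b = 0 \<or> degree a = 0" using least nz by fastforce
    then show "a dvd 1 \<or> b dvd 1" using nz by (auto simp: is_unit_iff_degree)
  qed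
  with pq m that show ?thesis by blast
qed

lemma simple_root_order:
  fixes p :: "'k::field poly"
  assumes "p \<noteq> 0" "poly p x = 0"
  shows "order x p = 1 \<longleftrightarrow> poly (pderiv p) x \<noteq> 0"
proof -
  obtain q where q: "p = [:- x, 1:] * q" using assms(2) poly_eq_0_iff_dvd by (metis dvd_def)
  then have "q \<noteq> 0" using assms by auto
  moreover have "order x [:- x, 1:] = 1" using order_power_n_n[of x 1] by simp
  moreover have "order x p = order x [:- x, 1:] + order x q"
    unfolding q by (rule order_mult) (use assms(1) q in metis)
  ultimately have "order x p = Suc (order x q)" by simp
  moreover have "poly (pderiv p) x = poly q x" by (subst q) (simp only: pderiv_mult, simp add: pderiv_pCons)
  ultimately show ?thesis using \<open>q \<noteq> 0\<close> by (simp add: order_root)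
qed

text \<open>If \<open>x\<close> is a simple root of some polynomial, it is a simple root of its minimal polynomial, and
  so are all its conjugates, which makes the minimal polynomial squarefree.\<close>

lemma sep_closure_iff_separable: "x \<in> sep_closure \<longleftrightarrow> separable x"
proof
  assume "x \<in> sep_closure"
  then obtain p :: "'a poly" where p: "poly (map_poly to_ac p) x = 0" "rsquarefree (map_poly to_ac p)"
    unfolding sep_closure_def by blast
  then have "order x (map_poly to_ac p) = 1" by (metis rsquarefree_def rsquarefree_root_order)
  then show "separable x"
    using simple_root_order[of "map_poly to_ac p" x] p
    unfolding separable_def pderiv_map_poly_to_ac[symmetric] by (auto simp: rsquarefree_def)
next
  assume "separable x"
  then obtain f :: "'a poly" where f: "poly (map_poly to_ac f) x = 0"
      "poly (pderiv (map_poly to_ac f)) x \<noteq> 0"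
    unfolding separable_def pderiv_map_poly_to_ac by blast
  interpret partial_embedding "Id_on (range to_ac)"
    by (rule partial_embedding_Id_on[OF base_subring_range])
  obtain m :: "'a poly" where m: "Factorial_Ring.irreducible m"
      "minimal_lift x (map_poly to_ac m) (map_poly to_ac m)"
    using minimal_polynomial by blast
  let ?m = "map_poly to_ac m"
  have root: "poly ?m x = 0" using m by (simp add: minimal_lift_def)
  have "poly (pderiv ?m) y \<noteq> 0" if "poly ?m y = 0" for y
    using minimal_lift_simple_conjugates[OF m(2) minimal_lift_simple_root[OF m(2) lifts_base f] that] .
  moreover have nz: "?m \<noteq> 0" using m(1) map_poly_to_ac_eq_iff[of m 0] by auto
  ultimately have "order y ?m = 0 \<or> order y ?m = 1" for y
    using simple_root_order[of ?m y] by (cases "poly ?m y = 0") (auto simp: order_root)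
  then have "rsquarefree ?m" using nz by (simp add: rsquarefree_def)
  then show "x \<in> sep_closure" unfolding sep_closure_def using m(1) root by blast
qed

text \<open>Up to a constant, \<open>p\<close> is the minimal polynomial of \<open>x\<close>, so the identity of the base field
  extends to a partial embedding sending \<open>x\<close> to \<open>y\<close>, and from there to the whole closure.\<close>

lemma conjugate_by_base_hom:
  fixes p :: "'a::field poly"
  assumes irr: "Factorial_Ring.irreducible p"
    and x: "poly (map_poly to_ac p) x = 0" and y: "poly (map_poly to_ac p) y = 0"
  obtains \<tau> where "base_hom \<tau>" "\<tau> x = y"
proof -
  interpret partial_embedding "Id_on (range to_ac)"
    by (rule partial_embedding_Id_on[OF base_subring_range])
  obtain m :: "'a poly" where m: "Factorial_Ring.irreducible m"
      "minimal_lift x (map_poly to_ac m) (map_poly to_ac m)"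
    using minimal_polynomial by blast
  obtain k l where kl: "lifts k l" "map_poly to_ac p = map_poly to_ac m * k"
    using minimal_lift_dvd[OF m(2) lifts_base x] by blast
  then obtain k' where "k = map_poly to_ac k'" unfolding lifts_range_to_ac by blast
  with kl have "p = m * k'" by (simp add: map_poly_to_ac_eq_iff flip: map_poly_to_ac_mult)
  moreover have "\<not> m dvd 1" using m(1) Factorial_Ring.irreducible_not_unit by blast
  ultimately have "k' dvd 1" using Factorial_Ring.irreducibleD[OF irr] by blast
  then obtain c where c: "k' = [:c:]" "c dvd 1" by (rule is_unit_polyE)
  have "map_poly to_ac p = map_poly to_ac m * [:to_ac c:]"
    unfolding \<open>p = m * k'\<close> c(1) map_poly_to_ac_mult by (simp add: map_poly_pCons)
  moreover have "c \<noteq> 0" using c(2) by auto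
  ultimately have "poly (map_poly to_ac m) y = 0" using y by simp
  then have "partial_embedding (adjoin x y)" by (rule adjoin_partial_embedding[OF m(2)])
  then obtain \<tau> where \<tau>: "base_hom \<tau>" "\<And>v w. (v, w) \<in> adjoin x y \<Longrightarrow> \<tau> v = w"
    by (rule partial_embedding_extends) blast
  show ?thesis by (rule that[OF \<tau>(1) \<tau>(2)[OF adjoin_gen]])
qed

text \<open>If $z = g(z^p)$, then $z$ is a root of $g(X^p) - X$, whose derivative is the constant
  $-1$.\<close>

lemma separable_if_mem_adjoin_power:
  assumes "CHAR('a::field) > 0" and z: "z \<in> ring_adjoin (range (to_ac :: 'a \<Rightarrow> _)) (z ^ CHAR('a))"
  shows "separable z"
proof -
  let ?c = "CHAR('a)"
  obtain p where "\<forall>i. coeff p i \<in> range (to_ac :: 'a \<Rightarrow> _)" "z = poly p (z ^ ?c)"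
    using z by (auto simp: ring_adjoin_def)
  then obtain g :: "'a poly" where g: "z = poly (map_poly to_ac g) (z ^ ?c)"
    by (metis coeffs_in_range_to_ac)
  define f where "f = pcompose g (monom 1 ?c) - [:0, 1:]"
  have add: "map_poly to_ac (r + s) = map_poly to_ac r + map_poly to_ac s"
    and diff: "map_poly to_ac (r - s) = map_poly to_ac r - map_poly to_ac s" for r s :: "'a poly"
    by (simp_all add: poly_eq_iff coeff_map_poly)
  have "map_poly to_ac (pcompose r s) = pcompose (map_poly to_ac r) (map_poly to_ac s)" for r s :: "'a poly"
    by (induction r) (simp_all add: pcompose_pCons map_poly_pCons map_poly_to_ac_mult add)
  then have "map_poly to_ac f = pcompose (map_poly to_ac g) (monom 1 ?c) - [:0, 1:]"
    unfolding f_def by (simp add: diff map_poly_monom map_poly_pCons)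
  then have "poly (map_poly to_ac f) z = 0" using g by (simp add: poly_pcompose poly_monom)
  moreover have "pderiv f = [:-1:]"
    unfolding f_def by (simp add: pderiv_diff pderiv_pcompose pderiv_monom pderiv_pCons)
  then have "poly (map_poly to_ac (pderiv f)) z \<noteq> 0" by (simp add: map_poly_pCons)
  ultimately show ?thesis unfolding separable_def by blast
qed

text \<open>The derivative of the minimal polynomial is nonzero and of smaller degree, so it cannot vanish
  at \<open>z\<close>.\<close>

lemma separable_char_0:
  assumes "CHAR('a::field) = 0"
  shows "separable (z :: 'a alg_closure)"
proof -
  interpret partial_embedding "Id_on (range (to_ac :: 'a \<Rightarrow> _))"
    by (rule partial_embedding_Id_on[OF base_subring_range])
  obtain m :: "'a poly" where m: "Factorial_Ring.irreducible m"
      "minimal_lift z (map_poly to_ac m) (map_poly to_ac m)"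
    using minimal_polynomial by blast
  have deg: "degree m > 0" using minimal_lift_degree_pos[OF m(2)] by simp
  have "coeff (pderiv m) (degree m - 1) = of_nat (degree m) * lead_coeff m"
    using deg by (simp add: coeff_pderiv del: of_nat_Suc)
  also have "\<dots> \<noteq> 0" using deg assms by (auto simp: of_nat_eq_0_iff_char_dvd)
  finally have nz: "pderiv m \<noteq> 0" by auto
  have "degree (pderiv m) < degree m"
    using deg by (intro degree_lessI) (auto simp: nz coeff_pderiv coeff_eq_0)
  then have "poly (map_poly to_ac (pderiv m)) z \<noteq> 0"
    using m(2) nz lifts_base[of "pderiv m"] map_poly_to_ac_eq_iff[of "pderiv m" 0]
    unfolding minimal_lift_def by (metis degree_map_poly_to_ac leD map_poly_0)
  then show ?thesis using m(2) unfolding separable_def minimal_lift_def by blast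
qed

text \<open>
  In characteristic $p > 0$ let $K = F[z^p]$, where $F$ is the base field. Then
  $z \in K[x][y]$ and $z^p \in K$, so \<open>separable_adjoin_purely_inseparable\<close>, applied over $K[x]$
  and then over $K$, gives $z \in K[x]$ and then $z \in K$. But $z \in F[z^p]$ means that
  $z$ is separable.
\<close>

lemma separable_in_adjoin_two:
  fixes x y z :: "'a::field alg_closure"
  assumes "separable x" "separable y"
    and z: "z \<in> ring_adjoin (ring_adjoin (range to_ac) x) y"
  shows "separable z"
proof (cases "CHAR('a) = 0")
  case False
  then have c: "CHAR('a) > 0" by simp
  define K where "K = ring_adjoin (range to_ac) (z ^ CHAR('a))"
  note F = base_subring_range
  have K: "base_subring K" unfolding K_def by (rule base_subring_adjoin[OF F])
  have L: "base_subring (ring_adjoin K x)" by (rule base_subring_adjoin[OF K])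
  have FK: "range to_ac \<subseteq> K" unfolding K_def by (rule ring_adjoin_supset[OF F])
  have KL: "K \<subseteq> ring_adjoin K x" by (rule ring_adjoin_supset[OF K])
  have zK: "z ^ CHAR('a) \<in> K" unfolding K_def by (rule ring_adjoin_gen[OF F])
  from assms obtain f g :: "'a poly" where
    f: "poly (map_poly to_ac f) x = 0" "poly (pderiv (map_poly to_ac f)) x \<noteq> 0" and
    g: "poly (map_poly to_ac g) y = 0" "poly (pderiv (map_poly to_ac g)) y \<noteq> 0"
    unfolding separable_def pderiv_map_poly_to_ac by blast
  have coeffs: "coeff (map_poly to_ac p) i \<in> K" for p :: "'a poly" and i
    using FK by (auto simp: coeff_map_poly)
  have "z \<in> ring_adjoin (ring_adjoin K x) y"
    using z ring_adjoin_mono[OF ring_adjoin_mono[OF FK]] by blast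
  then have "z \<in> ring_adjoin K x"
    using separable_adjoin_purely_inseparable[OF c L _ g] coeffs zK KL by blast
  then have "z \<in> K"
    using separable_adjoin_purely_inseparable[OF c K _ f] coeffs zK by blast
  then show ?thesis unfolding K_def using separable_if_mem_adjoin_power[OF c] by blast
qed (rule separable_char_0)

lemma base_subring_sep_closure: "base_subring (sep_closure :: 'a::field alg_closure set)"
proof -
  have "separable (to_ac c)" for c :: 'a
    unfolding separable_def by (rule exI[of _ "[:- c, 1:]"]) (simp add: map_poly_pCons pderiv_pCons)
  moreover have "separable (x + y) \<and> separable (x * y)"
    if "separable x" "separable y" for x y :: "'a alg_closure"
  proof -
    let ?F = "range (to_ac :: 'a \<Rightarrow> _)"
    let ?L = "ring_adjoin (ring_adjoin ?F x) y"
    have 1: "base_subring (ring_adjoin ?F x)" by (rule base_subring_adjoin[OF base_subring_range])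
    have "x \<in> ?L" using ring_adjoin_gen[OF base_subring_range] ring_adjoin_supset[OF 1] by blast
    moreover have "y \<in> ?L" by (rule ring_adjoin_gen[OF 1])
    ultimately have "x + y \<in> ?L" "x * y \<in> ?L"
      using base_subring_adjoin[OF 1] by (auto simp: base_subring_def)
    then show ?thesis using separable_in_adjoin_two[OF that] by blast
  qed
  ultimately show ?thesis by (auto simp: base_subring_def sep_closure_iff_separable)
qed

lemma
  shows sep_closure_const: "to_ac c \<in> sep_closure"
    and sep_closure_add: "x \<in> sep_closure \<Longrightarrow> y \<in> sep_closure \<Longrightarrow> x + y \<in> sep_closure"
    and sep_closure_mult: "x \<in> sep_closure \<Longrightarrow> y \<in> sep_closure \<Longrightarrow> x * y \<in> sep_closure"
    and sep_closure_diff: "x \<in> sep_closure \<Longrightarrow> y \<in> sep_closure \<Longrightarrow> x - y \<in> sep_closure"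
    and sep_closure_divide: "x \<in> sep_closure \<Longrightarrow> y \<in> sep_closure \<Longrightarrow> x / y \<in> sep_closure"
proof -
  interpret partial_embedding "Id_on sep_closure"
    by (rule partial_embedding_Id_on[OF base_subring_sep_closure])
  show "to_ac c \<in> sep_closure" using const_mem by blast
  show "x + y \<in> sep_closure" "x * y \<in> sep_closure" "x - y \<in> sep_closure"
    if "x \<in> sep_closure" "y \<in> sep_closure" for x y
    using add_mem mult_mem diff_mem that by blast+
  have inv: "inverse x \<in> sep_closure" if "x \<in> sep_closure" for x
    using inverse_mem[of x x] that by (cases "x = 0") auto
  show "x / y \<in> sep_closure" if "x \<in> sep_closure" "y \<in> sep_closure" for x y
    unfolding divide_inverse using mult_mem inv that by blast
qed

section \<open>The absolute Galois group and its fixed field\<close>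

lemma restrict_base_hom_galois:
  fixes \<tau> :: "'a::field alg_closure \<Rightarrow> 'a alg_closure"
  assumes \<tau>: "base_hom \<tau>"
  shows "restrict \<tau> sep_closure \<in> carrier abs_galois_group"
proof -
  have "bij_betw \<tau> sep_closure sep_closure"
    unfolding bij_betw_def
  proof (intro conjI subset_antisym subsetI)
    show "inj_on \<tau> sep_closure" using base_hom_inj[OF \<tau>] by (rule inj_on_subset) simp
  next
    fix y :: "'a alg_closure"
    show "y \<in> sep_closure" if "y \<in> \<tau> ` sep_closure"
    proof -
      from that obtain x p where p: "y = \<tau> x" "Factorial_Ring.irreducible p"
         "poly (map_poly to_ac p) x = 0" "rsquarefree (map_poly to_ac p)"
        unfolding sep_closure_def by blast
      have "poly (map_poly to_ac p) y = 0"
        using base_hom_poly[OF \<tau>, of p x] p by (simp add: base_hom_0[OF \<tau>])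
      with p show ?thesis unfolding sep_closure_def by blast
    qed
  next
    fix y :: "'a alg_closure"
    show "y \<in> \<tau> ` sep_closure" if "y \<in> sep_closure"
    proof -
      from that obtain p :: "'a poly" where p: "Factorial_Ring.irreducible p"
         "poly (map_poly to_ac p) y = 0" "rsquarefree (map_poly to_ac p)"
        unfolding sep_closure_def by blast
      then have "p \<noteq> 0" by auto
      with p have "y \<in> \<tau> ` {x. poly (map_poly to_ac p) x = 0}"
        using base_hom_permutes_roots[OF \<tau>, of p] by (auto simp: bij_betw_def)
      with p show ?thesis unfolding sep_closure_def by blast
    qed
  qed
  then show ?thesis
    by (auto simp: abs_galois_group_def Bij_def sep_closure_const sep_closure_add sep_closure_mult
        base_hom_add[OF \<tau>] base_hom_mult[OF \<tau>] base_hom_const[OF \<tau>])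
qed

text \<open>All conjugates of \<open>z\<close> are images of \<open>z\<close> under endomorphisms, so \<open>z\<close> is the only root of its
  minimal polynomial. As the roots are simple, this polynomial is linear.\<close>

lemma fixed_separable_in_base:
  fixes z :: "'a::field alg_closure"
  assumes z: "z \<in> sep_closure" and fixed: "\<And>\<tau>. base_hom \<tau> \<Longrightarrow> \<tau> z = z"
  shows "z \<in> range to_ac"
proof -
  from z obtain p :: "'a poly" where p: "Factorial_Ring.irreducible p"
     "poly (map_poly to_ac p) z = 0" "rsquarefree (map_poly to_ac p)"
    unfolding sep_closure_def by blast
  let ?p = "map_poly to_ac p"
  have nz: "?p \<noteq> 0" using p(3) by (simp add: rsquarefree_def)
  have "{x. poly ?p x = 0} = {z}"
  proof -
    have "x = z" if root: "poly ?p x = 0" for x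
    proof -
      obtain \<tau> where "base_hom \<tau>" "\<tau> z = x" by (rule conjugate_by_base_hom[OF p(1,2) root])
      then show ?thesis using fixed by blast
    qed
    then show ?thesis using p(2) by blast
  qed
  moreover have "card {x. poly ?p x = 0} = degree ?p"
  proof (rule card_roots_eq_degree[OF nz])
    show "poly (pderiv ?p) x \<noteq> 0" if "poly ?p x = 0" for x
      using simple_root_order[OF nz that] rsquarefree_root_order[OF p(3) that nz] by simp
  qed
  ultimately have "degree p = 1" by simp
  moreover obtain b q where "p = pCons b q" by (cases p)
  ultimately obtain c where bc: "p = [:b, c:]" "c \<noteq> 0"
    by (auto split: if_splits elim: degree_eq_zeroE)
  then have "to_ac b + z * to_ac c = 0" using p(2) by (simp add: map_poly_pCons)
  then have "z = to_ac (- b / c)" using bc by (simp add: field_simps add_eq_0_iff)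
  then show ?thesis by blast
qed

lemma
  fixes \<sigma> :: "'a::field alg_closure \<Rightarrow> 'a alg_closure"
  assumes \<sigma>: "\<sigma> \<in> carrier abs_galois_group"
  shows galois_add: "x \<in> sep_closure \<Longrightarrow> y \<in> sep_closure \<Longrightarrow> \<sigma> (x + y) = \<sigma> x + \<sigma> y"
    and galois_mult: "x \<in> sep_closure \<Longrightarrow> y \<in> sep_closure \<Longrightarrow> \<sigma> (x * y) = \<sigma> x * \<sigma> y"
    and galois_const: "\<sigma> (to_ac c) = to_ac c"
  using \<sigma> by (auto simp: abs_galois_group_def)

lemma sep_closure_poly:
  "x \<in> sep_closure \<Longrightarrow> poly (map_poly to_ac p) x \<in> sep_closure"
  by (induction p) (use sep_closure_const[of 0] in
      \<open>auto simp: map_poly_pCons intro!: sep_closure_add sep_closure_mult sep_closure_const\<close>)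

lemma galois_poly:
  assumes \<sigma>: "\<sigma> \<in> carrier abs_galois_group" and x: "x \<in> sep_closure"
  shows "\<sigma> (poly (map_poly to_ac p) x) = poly (map_poly to_ac p) (\<sigma> x)"
proof (induction p)
  case 0 then show ?case using galois_const[OF \<sigma>, of 0] by simp
next
  case (pCons c p)
  then show ?case
    by (simp add: map_poly_pCons galois_add[OF \<sigma>] galois_mult[OF \<sigma>] galois_const[OF \<sigma>] x
        sep_closure_const sep_closure_mult sep_closure_poly)
qed

section \<open>Galois-equivariant bijections\<close>

definition equivariantly_bijective :: "'a::field alg_closure set \<Rightarrow> 'a alg_closure set \<Rightarrow> bool" where
  "equivariantly_bijective R S \<longleftrightarrow> (\<exists>\<psi>. bij_betw \<psi> R S \<and>
     (\<forall>\<sigma>\<in>carrier abs_galois_group. \<forall>x\<in>R. \<sigma> x \<in> R \<and> \<psi> (\<sigma> x) = \<sigma> (\<psi> x)))"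

lemma equivariantly_bijective_sym:
  assumes "equivariantly_bijective R S"
  shows "equivariantly_bijective S R"
proof -
  obtain \<psi> where \<psi>: "bij_betw \<psi> R S"
     "\<And>\<sigma> x. \<sigma> \<in> carrier abs_galois_group \<Longrightarrow> x \<in> R \<Longrightarrow> \<sigma> x \<in> R \<and> \<psi> (\<sigma> x) = \<sigma> (\<psi> x)"
    using assms unfolding equivariantly_bijective_def by blast
  have "\<sigma> y \<in> S \<and> inv_into R \<psi> (\<sigma> y) = \<sigma> (inv_into R \<psi> y)"
    if \<sigma>: "\<sigma> \<in> carrier abs_galois_group" and y: "y \<in> S" for \<sigma> y
  proof -
    obtain x where x: "x \<in> R" "y = \<psi> x" using y \<psi>(1) by (auto simp: bij_betw_def)
    then have "\<sigma> y = \<psi> (\<sigma> x)" "\<sigma> x \<in> R" using \<psi>(2) \<sigma> by auto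
    then show ?thesis using x \<psi>(1) by (auto simp: bij_betw_def)
  qed
  then show ?thesis
    unfolding equivariantly_bijective_def using bij_betw_inv_into[OF \<psi>(1)] by blast
qed

lemma equivariantly_bijective_trans:
  assumes "equivariantly_bijective R S" "equivariantly_bijective S T"
  shows "equivariantly_bijective R T"
proof -
  obtain \<psi> where \<psi>: "bij_betw \<psi> R S"
     "\<And>\<sigma> x. \<sigma> \<in> carrier abs_galois_group \<Longrightarrow> x \<in> R \<Longrightarrow> \<sigma> x \<in> R \<and> \<psi> (\<sigma> x) = \<sigma> (\<psi> x)"
    using assms(1) unfolding equivariantly_bijective_def by blast
  obtain \<chi> where \<chi>: "bij_betw \<chi> S T"
     "\<And>\<sigma> x. \<sigma> \<in> carrier abs_galois_group \<Longrightarrow> x \<in> S \<Longrightarrow> \<sigma> x \<in> S \<and> \<chi> (\<sigma> x) = \<sigma> (\<chi> x)"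
    using assms(2) unfolding equivariantly_bijective_def by blast
  have "bij_betw (\<chi> \<circ> \<psi>) R T" using \<psi>(1) \<chi>(1) by (rule bij_betw_trans)
  moreover have "\<psi> x \<in> S" if "x \<in> R" for x using that \<psi>(1) by (auto simp: bij_betw_def)
  ultimately show ?thesis
    unfolding equivariantly_bijective_def using \<psi>(2) \<chi>(2) by (intro exI[of _ "\<chi> \<circ> \<psi>"]) auto
qed

text \<open>Polynomial maps over the base field commute with Galois. Shifts, twists and the quadratic maps of
  the main construction are all of this form.\<close>

lemma equivariantly_bijective_poly:
  fixes f h :: "'a::field poly"
  assumes R: "R = {x. poly (map_poly to_ac f) x = 0}" "R \<subseteq> sep_closure"
    and bij: "bij_betw (poly (map_poly to_ac h)) R S"
  shows "equivariantly_bijective R S"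
proof -
  have "\<sigma> x \<in> R" if \<sigma>: "\<sigma> \<in> carrier abs_galois_group" and x: "x \<in> R" for \<sigma> x
  proof -
    have "poly (map_poly to_ac f) (\<sigma> x) = \<sigma> (to_ac 0)"
      using galois_poly[OF \<sigma>, of x f] x R by auto
    then show ?thesis using R(1) galois_const[OF \<sigma>, of 0] by simp
  qed
  moreover have "poly (map_poly to_ac h) (\<sigma> x) = \<sigma> (poly (map_poly to_ac h) x)"
    if "\<sigma> \<in> carrier abs_galois_group" "x \<in> R" for \<sigma> x
    using galois_poly[OF that(1)] that(2) R(2) by (metis subsetD)
  ultimately show ?thesis
    unfolding equivariantly_bijective_def using bij by blast
qed

section \<open>The cubic of 2-torsion abscissas\<close>

fun weierstrass_c6 :: "'k::field weierstrass \<Rightarrow> 'k" where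
  "weierstrass_c6 (Weierstrass a1 a2 a3 a4 a6) =
     (let b2 = a1^2 + 4 * a2; b4 = 2 * a4 + a1 * a3; b6 = a3^2 + 4 * a6
      in - (b2^3) + 36 * b2 * b4 - 216 * b6)"

text \<open>This is $4x^3 + b_2x^2 + 2b_4x + b_6$. The Weierstrass equation takes the form $(2y + a_1x + a_3)^2 =
  4x^3 + b_2x^2 + 2b_4x + b_6$ after completing the square, and a point is $2$-torsion iff the left
  side vanishes.\<close>

fun two_division_poly :: "'k::field weierstrass \<Rightarrow> 'k poly" where
  "two_division_poly (Weierstrass a1 a2 a3 a4 a6) =
     (let b2 = a1^2 + 4 * a2; b4 = 2 * a4 + a1 * a3; b6 = a3^2 + 4 * a6 in [:b6, 2 * b4, b2, 4:])"

fun two_torsion_point :: "'k::field weierstrass \<Rightarrow> 'k \<Rightarrow> 'k point" where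
  "two_torsion_point (Weierstrass a1 a2 a3 a4 a6) x = Affine x (- (a1 * x + a3) / 2)"

fun b2_invariant :: "'k::field weierstrass \<Rightarrow> 'k" where
  "b2_invariant (Weierstrass a1 a2 a3 a4 a6) = a1^2 + 4 * a2"

lemma c4_c6_disc: "1728 * weierstrass_disc W = weierstrass_c4 W ^ 3 - weierstrass_c6 W ^ 2"
proof (cases W)
  case (Weierstrass a1 a2 a3 a4 a6)
  have identity: "1728 * (- (b2^2 * b8) - 8 * b4^3 - 27 * b6^2 + 9 * b2 * b4 * b6) =
      (b2^2 - 24 * b4)^3 - (- (b2^3) + 36 * b2 * b4 - 216 * b6)^2"
    if "4 * b8 = b2 * b6 - b4^2" for b2 b4 b6 b8 :: 'a
  proof -
    have "1728 * (- (b2^2 * b8) - 8 * b4^3 - 27 * b6^2 + 9 * b2 * b4 * b6) =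
        - 432 * b2^2 * (4 * b8) + 1728 * (- 8 * b4^3 - 27 * b6^2 + 9 * b2 * b4 * b6)"
      by (simp add: algebra_simps)
    then show ?thesis unfolding that by (simp add: algebra_simps power2_eq_square power3_eq_cube)
  qed
  show ?thesis
    unfolding Weierstrass weierstrass_disc.simps weierstrass_c4.simps weierstrass_c6.simps Let_def
    by (rule identity) (simp add: algebra_simps power2_eq_square)
qed

text \<open>The expression in the assumption is minus the square of the product of the differences of the
  roots.\<close>

lemma depressed_cubic_splits:
  fixes A B :: "'k::alg_closed_field"
  assumes disc: "4 * A^3 + 27 * B^2 \<noteq> 0"
  obtains r1 r2 r3 where "r1 + r2 + r3 = 0" "r1 * r2 + r1 * r3 + r2 * r3 = A" "r1 * r2 * r3 = - B"
    "r1 \<noteq> r2" "r1 \<noteq> r3" "r2 \<noteq> r3" "{x. x^3 + A * x + B = 0} = {r1, r2, r3}"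
proof -
  have "\<exists>x. poly [:B, A, 0, 1:] x = 0" by (rule alg_closed_imp_poly_has_root) simp
  then obtain r1 where r1: "r1^3 + A * r1 + B = 0" by (auto simp: algebra_simps power3_eq_cube)
  have "\<exists>x. poly [:A + r1^2, r1, 1:] x = 0" by (rule alg_closed_imp_poly_has_root) simp
  then obtain r2 where r2: "r2^2 + r1 * r2 + A + r1^2 = 0"
    by (auto simp: algebra_simps power2_eq_square)
  define r3 where "r3 = - r1 - r2"
  have "A + (r1^2 + r1 * r2 + r2^2) = 0" using r2 by (simp add: ac_simps)
  then have A: "A = - (r1^2 + r1 * r2 + r2^2)" by (simp only: eq_neg_iff_add_eq_0)
  have B: "B = r1 * r2 * (r1 + r2)" using r1 unfolding A by (simp add: algebra_simps power2_eq_square power3_eq_cube eq_neg_iff_add_eq_0)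
  have "4 * A^3 + 27 * B^2 = - (((r1 - r2) * (r1 - r3) * (r2 - r3))^2)"
    unfolding A B r3_def by (simp add: algebra_simps power2_eq_square power3_eq_cube)
  with disc have "r1 \<noteq> r2" "r1 \<noteq> r3" "r2 \<noteq> r3" by auto
  moreover have "x^3 + A * x + B = (x - r1) * (x - r2) * (x - r3)" for x
    unfolding A B r3_def by (simp add: algebra_simps power2_eq_square power3_eq_cube)
  then have "{x. x^3 + A * x + B = 0} = {r1, r2, r3}" by auto
  moreover have "r1 + r2 + r3 = 0" "r1 * r2 + r1 * r3 + r2 * r3 = A" "r1 * r2 * r3 = - B"
    unfolding A B r3_def by (simp_all add: algebra_simps power2_eq_square)
  ultimately show ?thesis using that by blast
qed

definition cubic_roots :: "'a::field \<Rightarrow> 'a \<Rightarrow> 'a alg_closure set" where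
  "cubic_roots A B = {x. x^3 + to_ac A * x + to_ac B = 0}"

definition two_division_roots :: "'a::field weierstrass \<Rightarrow> 'a alg_closure set" where
  "two_division_roots W = {x. poly (map_poly to_ac (two_division_poly W)) x = 0}"

text \<open>Substituting $x = X - b_2/12$ into the cubic $4x^3 + b_2x^2 + 2b_4x + b_6$ and dividing by $4$ gives
  $X^3 + AX + B$ with $A = -c_4/48$ and $B = -c_6/864$.\<close>

definition reduced_a :: "'k::field weierstrass \<Rightarrow> 'k" where
  "reduced_a W = - weierstrass_c4 W / 48"

definition reduced_b :: "'k::field weierstrass \<Rightarrow> 'k" where
  "reduced_b W = - weierstrass_c6 W / 864"

lemma two_three_nonzero:
  assumes "CHAR('k::field) \<noteq> 2" "CHAR('k) \<noteq> 3"
  shows "(2::'k) \<noteq> 0" "(3::'k) \<noteq> 0"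
proof -
  have "\<not> CHAR('k) dvd p" if "prime p" "CHAR('k) \<noteq> p" for p :: nat
    using that CHAR_not_1' by (metis One_nat_def prime_nat_iff)
  from this[of 2] this[of 3] have "of_nat 2 \<noteq> (0::'k)" "of_nat 3 \<noteq> (0::'k)"
    unfolding of_nat_eq_0_iff_char_dvd using assms by simp_all
  then show "(2::'k) \<noteq> 0" "(3::'k) \<noteq> 0" by simp_all
qed

lemma numerals_nonzero:
  assumes "(2::'k::field) \<noteq> 0" "(3::'k) \<noteq> 0"
  shows "(4::'k) \<noteq> 0" "(12::'k) \<noteq> 0" "(16::'k) \<noteq> 0" "(27::'k) \<noteq> 0" "(48::'k) \<noteq> 0" "(864::'k) \<noteq> 0" "(1728::'k) \<noteq> 0"
proof -
  have "(4::'k) = 2^2" "(12::'k) = 2^2*3" "(16::'k) = 2^4" "(27::'k) = 3^3" "(48::'k) = 2^4*3"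
    "(864::'k) = 2^5*3^3" "(1728::'k) = 2^6*3^3" by simp_all
  then show "(4::'k) \<noteq> 0" "(12::'k) \<noteq> 0" "(16::'k) \<noteq> 0" "(27::'k) \<noteq> 0" "(48::'k) \<noteq> 0" "(864::'k) \<noteq> 0" "(1728::'k) \<noteq> 0"
    using assms by (metis mult_eq_0_iff power_not_zero)+
qed

text \<open>An affine point doubles to infinity iff $2y = -(a_1x + a_3)$, and for this \<open>y\<close> the curve equation
  becomes the vanishing of the cubic at \<open>x\<close>. The ordinate is separable along with the abscissa
  because it is a linear expression in it over the base field.\<close>

lemma two_torsion_carrier:
  fixes W :: "'a::field weierstrass"
  assumes two: "(2::'a) \<noteq> 0" and sep: "two_division_roots W \<subseteq> sep_closure"
  shows "carrier (two_torsion W) =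
    insert Infinity (two_torsion_point (map_weierstrass to_ac W) ` two_division_roots W)"
proof (cases W)
  case (Weierstrass a1 a2 a3 a4 a6)
  have two': "(2::'a alg_closure) \<noteq> 0" using two to_ac_eq_0_iff[of "2::'a"] by simp
  have root: "x \<in> two_division_roots W \<longleftrightarrow>
     4 * x^3 + 4 * to_ac a2 * x^2 + 4 * to_ac a4 * x + 4 * to_ac a6 + (to_ac a1 * x + to_ac a3)^2 = 0" for x
    unfolding two_division_roots_def Weierstrass
    by (simp add: Let_def map_poly_pCons algebra_simps power2_eq_square power3_eq_cube)
  have curve: "y^2 + to_ac a1 * x * y + to_ac a3 * y = x^3 + to_ac a2 * x^2 + to_ac a4 * x + to_ac a6 \<longleftrightarrow>
     x \<in> two_division_roots W" if y: "2 * y = - (to_ac a1 * x + to_ac a3)" for x y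
  proof -
    have "4 * (x^3 + to_ac a2 * x^2 + to_ac a4 * x + to_ac a6 - (y^2 + to_ac a1 * x * y + to_ac a3 * y)) =
       4 * x^3 + 4 * to_ac a2 * x^2 + 4 * to_ac a4 * x + 4 * to_ac a6
        - (2 * y) * (2 * y + 2 * (to_ac a1 * x + to_ac a3))"
      by (simp add: algebra_simps power2_eq_square)
    also have "\<dots> = 4 * x^3 + 4 * to_ac a2 * x^2 + 4 * to_ac a4 * x + 4 * to_ac a6 + (to_ac a1 * x + to_ac a3)^2"
      unfolding y by (simp add: algebra_simps power2_eq_square)
    finally show ?thesis
      unfolding root using two' by (metis (no_types, lifting) eq_iff_diff_eq_0 mult_eq_0_iff numeral_Bit0_eq_double)
  qed
  have y_sep: "- (to_ac a1 * x + to_ac a3) / 2 \<in> sep_closure" if "x \<in> sep_closure" for x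
    using sep_closure_divide[OF sep_closure_diff[OF sep_closure_diff[OF sep_closure_const[of 0] sep_closure_mult[OF sep_closure_const[of a1] that]] sep_closure_const[of a3]] sep_closure_const[of 2]]
    by simp
  have y_half: "y = - (to_ac a1 * x + to_ac a3) / 2 \<longleftrightarrow> 2 * y = - (to_ac a1 * x + to_ac a3)" for x y
    using two' by (simp add: field_simps)
  have y_sum: "y + y + to_ac a1 * x + to_ac a3 = 0 \<longleftrightarrow> 2 * y = - (to_ac a1 * x + to_ac a3)" for x y
    by (simp add: eq_neg_iff_add_eq_0 algebra_simps)
  have "P \<in> carrier (two_torsion W) \<longleftrightarrow>
     P \<in> insert Infinity (two_torsion_point (map_weierstrass to_ac W) ` two_division_roots W)" for P
  proof (cases P)
    case Infinity
    then show ?thesis by (simp add: two_torsion_def sep_points_def)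
  next
    case (Affine x y)
    have "P \<in> carrier (two_torsion W) \<longleftrightarrow> x \<in> sep_closure \<and> y \<in> sep_closure \<and>
        2 * y = - (to_ac a1 * x + to_ac a3) \<and> x \<in> two_division_roots W"
      unfolding Affine using curve[of y x] y_sum[of y x]
      by (auto simp: two_torsion_def sep_points_def Weierstrass Let_def)
    also have "\<dots> \<longleftrightarrow> 2 * y = - (to_ac a1 * x + to_ac a3) \<and> x \<in> two_division_roots W"
      using sep y_sep y_half by (metis subsetD)
    also have "\<dots> \<longleftrightarrow> P \<in> insert Infinity (two_torsion_point (map_weierstrass to_ac W) ` two_division_roots W)"
      unfolding y_half[symmetric] by (auto simp: Affine Weierstrass)
    finally show ?thesis .
  qed
  then show ?thesis by blast
qed

text \<open>The chord through two points on the line $2y = -(a_1x + a_3)$ is that line itself, so its third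
  intersection with the curve is the third $2$-torsion point. Its abscissa is found from the sum
  $-b_2/4$ of the roots of the cubic.\<close>

lemma
  fixes W :: "'a::field weierstrass"
  assumes two: "(2::'a) \<noteq> 0"
  shows two_torsion_point_double:
      "point_add (map_weierstrass to_ac W) (two_torsion_point (map_weierstrass to_ac W) x)
         (two_torsion_point (map_weierstrass to_ac W) x) = Infinity"
    and two_torsion_point_add:
      "x \<noteq> y \<Longrightarrow> point_add (map_weierstrass to_ac W) (two_torsion_point (map_weierstrass to_ac W) x)
         (two_torsion_point (map_weierstrass to_ac W) y) =
         two_torsion_point (map_weierstrass to_ac W) (- to_ac (b2_invariant W) / 4 - x - y)"
proof -
  obtain a1 a2 a3 a4 a6 where W: "W = Weierstrass a1 a2 a3 a4 a6" by (cases W)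
  have two': "(2::'a alg_closure) \<noteq> 0" using two to_ac_eq_0_iff[of "2::'a"] by simp
  have "(4::'a alg_closure) = 2 * 2" by simp
  then have four: "(4::'a alg_closure) \<noteq> 0" using two' by (metis mult_eq_0_iff)
  show "point_add (map_weierstrass to_ac W) (two_torsion_point (map_weierstrass to_ac W) x)
         (two_torsion_point (map_weierstrass to_ac W) x) = Infinity"
    using two' by (simp add: W field_simps)
  assume "x \<noteq> y"
  have "(8::'a alg_closure) = 2 * 4" by simp
  then have eight: "(8::'a alg_closure) \<noteq> 0" using two' four by (metis mult_eq_0_iff)
  have slope: "(- (to_ac a1 * y + to_ac a3) / 2 - - (to_ac a1 * x + to_ac a3) / 2) / (y - x) = - to_ac a1 / 2"
    using \<open>x \<noteq> y\<close> two' by (simp add: field_simps)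
  define q where "q = - to_ac (b2_invariant W) / 4 - x - y"
  have quarter: "(- to_ac a1 / 2)^2 + to_ac a1 * (- to_ac a1 / 2) - to_ac a2 - x - y = q"
    using two' four eight by (simp add: W q_def field_simps power2_eq_square)
  have ordinate: "- (- to_ac a1 / 2 + to_ac a1) * z - (- (to_ac a1 * x + to_ac a3) / 2 - - to_ac a1 / 2 * x) - to_ac a3
     = - (to_ac a1 * z + to_ac a3) / 2" for z
    using two' by (simp add: field_simps)
  have "point_add (map_weierstrass to_ac W) (two_torsion_point (map_weierstrass to_ac W) x)
         (two_torsion_point (map_weierstrass to_ac W) y) =
         two_torsion_point (map_weierstrass to_ac W) q"
    unfolding W
    by (simp only: weierstrass.map two_torsion_point.simps point_add.simps Let_def
        \<open>x \<noteq> y\<close> simp_thms if_False slope quarter ordinate)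
  then show "point_add (map_weierstrass to_ac W) (two_torsion_point (map_weierstrass to_ac W) x)
         (two_torsion_point (map_weierstrass to_ac W) y) =
         two_torsion_point (map_weierstrass to_ac W) (- to_ac (b2_invariant W) / 4 - x - y)"
    unfolding q_def .
qed

lemma reduced_disc:
  fixes W :: "'k::field weierstrass"
  assumes "(2::'k) \<noteq> 0" "(3::'k) \<noteq> 0"
  shows "16 * (4 * reduced_a W^3 + 27 * reduced_b W^2) = - weierstrass_disc W"
proof -
  note nz = numerals_nonzero[OF assms]
  have "weierstrass_c4 W = - 48 * reduced_a W" "weierstrass_c6 W = - 864 * reduced_b W"
    using nz by (simp_all add: reduced_a_def reduced_b_def)
  then have "1728 * weierstrass_disc W = 1728 * (- (16 * (4 * reduced_a W^3 + 27 * reduced_b W^2)))"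
    unfolding c4_c6_disc by (simp add: algebra_simps power2_eq_square power3_eq_cube)
  then have "weierstrass_disc W = - (16 * (4 * reduced_a W^3 + 27 * reduced_b W^2))"
    using nz(7) by (metis mult_cancel_left)
  then show ?thesis by simp
qed

lemma j_invariant_reduced:
  fixes W :: "'k::field weierstrass"
  assumes "(2::'k) \<noteq> 0" "(3::'k) \<noteq> 0"
  shows "j_invariant W = 1728 * (4 * reduced_a W^3) / (4 * reduced_a W^3 + 27 * reduced_b W^2)"
proof -
  note nz = numerals_nonzero[OF assms]
  have "weierstrass_c4 W = - 48 * reduced_a W"
    using nz by (simp add: reduced_a_def)
  then have "weierstrass_c4 W ^ 3 = - 16 * (1728 * (4 * reduced_a W^3))"
    by (simp add: power_mult_distrib)
  moreover have "weierstrass_disc W = - 16 * (4 * reduced_a W^3 + 27 * reduced_b W^2)"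
    using reduced_disc[OF assms, of W] by (simp add: algebra_simps eq_neg_iff_add_eq_0)
  ultimately show ?thesis
    unfolding j_invariant_def using nz(3)
    by (simp only: mult_divide_mult_cancel_left neg_equal_0_iff_equal not_False_eq_True)
qed

lemma reduced_short:
  fixes a b :: "'k::field"
  assumes "(2::'k) \<noteq> 0" "(3::'k) \<noteq> 0"
  shows "reduced_a (short_weierstrass a b) = a" "reduced_b (short_weierstrass a b) = b"
  using numerals_nonzero[OF assms] by (simp_all add: reduced_a_def reduced_b_def short_weierstrass_def)

lemma two_division_roots_shift:
  fixes W :: "'a::field weierstrass"
  assumes "(2::'a) \<noteq> 0" "(3::'a) \<noteq> 0"
  shows "x \<in> two_division_roots W \<longleftrightarrow>
    x + to_ac (b2_invariant W / 12) \<in> cubic_roots (reduced_a W) (reduced_b W)"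
proof -
  obtain a1 a2 a3 a4 a6 where W: "W = Weierstrass a1 a2 a3 a4 a6" by (cases W)
  note nz = numerals_nonzero[OF assms]
  define b2 b4 b6 where b: "b2 = a1^2 + 4 * a2" "b4 = 2 * a4 + a1 * a3" "b6 = a3^2 + 4 * a6"
  define B where "B = b2 / 12"
  have B: "b2 = 12 * B" using nz by (simp add: B_def)
  have c4: "b2^2 - 24 * b4 = - 48 * reduced_a W" and c6: "- (b2^3) + 36 * b2 * b4 - 216 * b6 = - 864 * reduced_b W"
    using nz by (simp_all add: W reduced_a_def reduced_b_def Let_def b)
  have eq: "1728 * ((x + to_ac B)^3 + to_ac (reduced_a W) * (x + to_ac B) + to_ac (reduced_b W)) =
     432 * (4 * x^3 + to_ac b2 * x^2 + 2 * to_ac b4 * x + to_ac b6)"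
  proof -
    have "1728 * ((x + to_ac B)^3 + to_ac (reduced_a W) * (x + to_ac B) + to_ac (reduced_b W)) =
      (12 * x + to_ac b2)^3 - 3 * (12 * x + to_ac b2) * to_ac (- 48 * reduced_a W) - 2 * to_ac (- 864 * reduced_b W)"
      unfolding B by (simp add: algebra_simps power2_eq_square power3_eq_cube)
    also have "\<dots> = 432 * (4 * x^3 + to_ac b2 * x^2 + 2 * to_ac b4 * x + to_ac b6)"
      unfolding c4[symmetric] c6[symmetric]
      by (simp add: algebra_simps power2_eq_square power3_eq_cube)
    finally show ?thesis .
  qed
  have "(432::'a) = 2^4 * 3^3" by simp
  then have "(432::'a) \<noteq> 0" using assms by (metis mult_eq_0_iff power_not_zero)
  then have "(432::'a alg_closure) \<noteq> 0" "(1728::'a alg_closure) \<noteq> 0"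
    using nz(7) to_ac_eq_0_iff[of "432::'a"] to_ac_eq_0_iff[of "1728::'a"] by simp_all
  then have "4 * x^3 + to_ac b2 * x^2 + 2 * to_ac b4 * x + to_ac b6 = 0 \<longleftrightarrow>
     (x + to_ac B)^3 + to_ac (reduced_a W) * (x + to_ac B) + to_ac (reduced_b W) = 0"
    using eq by (metis mult_eq_0_iff)
  moreover have "x \<in> two_division_roots W \<longleftrightarrow> 4 * x^3 + to_ac b2 * x^2 + 2 * to_ac b4 * x + to_ac b6 = 0"
    unfolding two_division_roots_def W b
    by (simp add: Let_def map_poly_pCons algebra_simps power2_eq_square power3_eq_cube)
  moreover have "b2_invariant W = b2" by (simp add: W b)
  ultimately show ?thesis unfolding cubic_roots_def B_def by simp
qed

lemma cubic_roots_obtain: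
  fixes A B :: "'a::field"
  assumes "4 * A^3 + 27 * B^2 \<noteq> 0"
  obtains r1 r2 r3 where "r1 + r2 + r3 = 0" "r1 * r2 + r1 * r3 + r2 * r3 = to_ac A"
    "r1 * r2 * r3 = - to_ac B" "r1 \<noteq> r2" "r1 \<noteq> r3" "r2 \<noteq> r3" "cubic_roots A B = {r1, r2, r3}"
proof -
  have "4 * to_ac A^3 + 27 * to_ac B^2 = to_ac (4 * A^3 + 27 * B^2)" by simp
  also have "\<dots> \<noteq> 0" using assms by (simp only: to_ac_eq_0_iff not_False_eq_True)
  finally show ?thesis
    unfolding cubic_roots_def by (rule depressed_cubic_splits) (rule that[unfolded cubic_roots_def])
qed

lemma cubic_roots_poly: "cubic_roots A B = {x. poly (map_poly to_ac [:B, A, 0, 1:]) x = 0}"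
  by (simp add: cubic_roots_def map_poly_pCons algebra_simps power3_eq_cube)

text \<open>The derivative at a root is the product of the differences to the other two roots.\<close>

lemma cubic_roots_separable:
  assumes "4 * A^3 + 27 * B^2 \<noteq> 0"
  shows "cubic_roots A B \<subseteq> sep_closure"
proof
  fix x assume x: "x \<in> cubic_roots A B"
  obtain r1 r2 r3 where r: "r1 + r2 + r3 = 0" "r1 * r2 + r1 * r3 + r2 * r3 = to_ac A"
    "r1 * r2 * r3 = - to_ac B"
    "r1 \<noteq> r2" "r1 \<noteq> r3" "r2 \<noteq> r3" "cubic_roots A B = {r1, r2, r3}"
    by (rule cubic_roots_obtain[OF assms])
  have r3: "r3 = - r1 - r2" using r(1) by (simp add: eq_neg_iff_add_eq_0 algebra_simps)
  have "3 * r1^2 + to_ac A = (r1 - r2) * (r1 - r3)" "3 * r2^2 + to_ac A = (r2 - r1) * (r2 - r3)"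
    "3 * r3^2 + to_ac A = (r3 - r1) * (r3 - r2)"
    unfolding r(2)[symmetric] r3 by (simp_all add: algebra_simps power2_eq_square)
  with x r(4-7) have "3 * x^2 + to_ac A \<noteq> 0" by auto
  moreover have "poly (map_poly to_ac (pderiv [:B, A, 0, 1:])) x = 3 * x^2 + to_ac A"
    by (simp add: pderiv_pCons map_poly_pCons algebra_simps power2_eq_square)
  ultimately have "separable x"
    using x unfolding separable_def cubic_roots_poly by (intro exI[of _ "[:B, A, 0, 1:]"]) simp
  then show "x \<in> sep_closure" by (simp add: sep_closure_iff_separable)
qed

lemma two_division_roots_obtain:
  fixes W :: "'a::field weierstrass"
  assumes char: "(2::'a) \<noteq> 0" "(3::'a) \<noteq> 0" and "elliptic_curve W"
  obtains r1 r2 r3 where "r1 \<noteq> r2" "r1 \<noteq> r3" "r2 \<noteq> r3" "two_division_roots W = {r1, r2, r3}"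
    "r1 + r2 + r3 = - to_ac (b2_invariant W) / 4"
    "two_division_roots W \<subseteq> sep_closure"
    "equivariantly_bijective (two_division_roots W) (cubic_roots (reduced_a W) (reduced_b W))"
proof -
  let ?s = "to_ac (b2_invariant W / 12)"
  let ?D = "cubic_roots (reduced_a W) (reduced_b W)"
  have D: "4 * reduced_a W^3 + 27 * reduced_b W^2 \<noteq> 0"
    using reduced_disc[OF char, of W] assms(3) unfolding elliptic_curve_def by (metis mult_zero_right neg_0_equal_iff_equal)
  obtain r1 r2 r3 where r: "r1 + r2 + r3 = 0" "r1 \<noteq> r2" "r1 \<noteq> r3" "r2 \<noteq> r3" "?D = {r1, r2, r3}"
    by (rule cubic_roots_obtain[OF D]) blast
  have mem: "x \<in> two_division_roots W \<longleftrightarrow> x + ?s \<in> ?D" for x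
    by (rule two_division_roots_shift[OF char])
  have R: "two_division_roots W = {r1 - ?s, r2 - ?s, r3 - ?s}"
    unfolding set_eq_iff mem r(5) by (auto simp: eq_diff_eq)
  have sep: "two_division_roots W \<subseteq> sep_closure"
    using cubic_roots_separable[OF D] r(5) R by (auto intro!: sep_closure_diff sep_closure_const simp del: to_ac_divide)
  have nz: "(4::'a alg_closure) \<noteq> 0" "(12::'a alg_closure) \<noteq> 0"
    using numerals_nonzero[OF char] to_ac_eq_0_iff[of "4::'a"] to_ac_eq_0_iff[of "12::'a"] by simp_all
  have "(r1 - ?s) + (r2 - ?s) + (r3 - ?s) = (r1 + r2 + r3) - 3 * ?s"
    by (simp add: algebra_simps del: to_ac_divide)
  also have "3 * ?s = to_ac (b2_invariant W) / 4" using nz by (simp add: field_simps)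
  also have "r1 + r2 + r3 - to_ac (b2_invariant W) / 4 = - to_ac (b2_invariant W) / 4"
    unfolding r(1) by simp
  finally have sum: "(r1 - ?s) + (r2 - ?s) + (r3 - ?s) = - to_ac (b2_invariant W) / 4" .
  have "bij_betw (poly (map_poly to_ac [:b2_invariant W / 12, 1:])) (two_division_roots W) ?D"
    unfolding R r(5) bij_betw_def by (auto simp: map_poly_pCons inj_on_def)
  then have "equivariantly_bijective (two_division_roots W) ?D"
    by (rule equivariantly_bijective_poly[OF two_division_roots_def sep])
  then show ?thesis using r R sum sep that[of "r1 - ?s" "r2 - ?s" "r3 - ?s"] by simp
qed

section \<open>Isomorphisms of 2-torsion modules as bijections of roots\<close>

lemma roots_from_two:
  fixes r1 r2 r3 :: "'k::ab_group_add"
  assumes "r1 \<noteq> r2" "r1 \<noteq> r3" "r2 \<noteq> r3" "R = {r1, r2, r3}" "r1 + r2 + r3 = t"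
    and "x \<in> R" "y \<in> R" "x \<noteq> y" and z: "z = t - x - y"
  shows "R = {x, y, z} \<and> z \<noteq> x \<and> z \<noteq> y"
proof -
  have "z = r1 + r2 + r3 - x - y" using assms(5) z by simp
  with assms(1-4,6-8) show ?thesis by (auto simp: algebra_simps)
qed

text \<open>
  An isomorphism maps infinity to infinity, because all doubles are infinity, and so restricts to a
  bijection between the nonzero points, that is between the roots. Conversely a bijection of the roots,
  extended by infinity, is additive: the sum of two different nonzero points is the third one.
\<close>

lemma two_torsion_isomorphic_iff:
  fixes V W :: "'a::field weierstrass"
  assumes char: "(2::'a) \<noteq> 0" "(3::'a) \<noteq> 0" and "elliptic_curve V" "elliptic_curve W"
  shows "two_torsion_isomorphic V W \<longleftrightarrow>
    equivariantly_bijective (two_division_roots V) (two_division_roots W)"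
proof -
  let ?R = "two_division_roots :: 'a weierstrass \<Rightarrow> _"
  let ?T = "\<lambda>U::'a weierstrass. two_torsion_point (map_weierstrass to_ac U)"
  have carrier: "carrier (two_torsion U) = insert Infinity (?T U ` ?R U)"
    and sep: "?R U \<subseteq> sep_closure"
    and third: "x \<in> ?R U \<Longrightarrow> y \<in> ?R U \<Longrightarrow> x \<noteq> y \<Longrightarrow>
      \<exists>z. ?T U x \<otimes>\<^bsub>two_torsion U\<^esub> ?T U y = ?T U z \<and> ?R U = {x, y, z} \<and> z \<noteq> x \<and> z \<noteq> y"
    if ell: "elliptic_curve U" for U x y
  proof -
    obtain r1 r2 r3 where r: "r1 \<noteq> r2" "r1 \<noteq> r3" "r2 \<noteq> r3" "?R U = {r1, r2, r3}"
      "r1 + r2 + r3 = - to_ac (b2_invariant U) / 4" and s: "?R U \<subseteq> sep_closure"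
      by (rule two_division_roots_obtain[OF char ell]) blast
    show "carrier (two_torsion U) = insert Infinity (?T U ` ?R U)"
      by (rule two_torsion_carrier[OF char(1) s])
    show "?R U \<subseteq> sep_closure" by (rule s)
    assume xy: "x \<in> ?R U" "y \<in> ?R U" "x \<noteq> y"
    show "\<exists>z. ?T U x \<otimes>\<^bsub>two_torsion U\<^esub> ?T U y = ?T U z \<and> ?R U = {x, y, z} \<and> z \<noteq> x \<and> z \<noteq> y"
      using roots_from_two[OF r xy refl] two_torsion_point_add[OF char(1) xy(3), of U]
      by (auto simp: two_torsion_def)
  qed
  have double: "?T U x \<otimes>\<^bsub>two_torsion U\<^esub> ?T U x = Infinity" for U x
    using two_torsion_point_double[OF char(1)] by (simp add: two_torsion_def)
  have unit: "Infinity \<otimes>\<^bsub>two_torsion U\<^esub> P = P" "P \<otimes>\<^bsub>two_torsion U\<^esub> Infinity = P" for U :: "'a weierstrass" and P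
    by (simp_all add: two_torsion_def) (cases P; simp)
  have T_inj: "?T U x = ?T U y \<longleftrightarrow> x = y" and T_inf: "?T U x \<noteq> Infinity" for U x y
  proof -
    obtain a1 a2 a3 a4 a6 where "U = Weierstrass a1 a2 a3 a4 a6" by (cases U)
    then have "?T U z = Affine z (- (to_ac a1 * z + to_ac a3) / 2)" for z by simp
    then show "?T U x = ?T U y \<longleftrightarrow> x = y" "?T U x \<noteq> Infinity" by auto
  qed
  have T_galois: "map_point \<sigma> (?T U x) = ?T U (\<sigma> x)"
    if \<sigma>: "\<sigma> \<in> carrier abs_galois_group" and x: "x \<in> sep_closure" for U \<sigma> x
  proof (cases U)
    case (Weierstrass a1 a2 a3 a4 a6)
    have "\<sigma> (poly (map_poly to_ac [:- a3 / 2, - a1 / 2:]) x) = poly (map_poly to_ac [:- a3 / 2, - a1 / 2:]) (\<sigma> x)"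
      by (rule galois_poly[OF \<sigma> x])
    moreover have "poly (map_poly to_ac [:- a3 / 2, - a1 / 2:]) w = - (to_ac a1 * w + to_ac a3) / 2" for w
      by (simp add: map_poly_pCons diff_divide_distrib)
    ultimately show ?thesis
      by (simp only: Weierstrass weierstrass.map two_torsion_point.simps point.map)
  qed
  note ell = assms(3,4)
  show ?thesis
  proof
    assume "two_torsion_isomorphic V W"
    then obtain \<phi> where \<phi>: "\<phi> \<in> iso (two_torsion V) (two_torsion W)"
      and eqv: "\<And>\<sigma> P. \<sigma> \<in> carrier abs_galois_group \<Longrightarrow> P \<in> carrier (two_torsion V) \<Longrightarrow>
          \<phi> (map_point \<sigma> P) = map_point \<sigma> (\<phi> P)"
      unfolding two_torsion_isomorphic_def by blast
    have hom: "\<phi> (P \<otimes>\<^bsub>two_torsion V\<^esub> Q) = \<phi> P \<otimes>\<^bsub>two_torsion W\<^esub> \<phi> Q"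
      if "P \<in> carrier (two_torsion V)" "Q \<in> carrier (two_torsion V)" for P Q
      using \<phi> that by (auto simp: iso_def hom_def)
    have bij: "bij_betw \<phi> (insert Infinity (?T V ` ?R V)) (insert Infinity (?T W ` ?R W))"
      using \<phi> by (simp add: iso_def carrier ell)
    have "P \<otimes>\<^bsub>two_torsion W\<^esub> P = Infinity" if "P \<in> insert Infinity (?T W ` ?R W)" for P
      using that double unit by auto
    moreover have "\<phi> Infinity \<in> insert Infinity (?T W ` ?R W)" using bij by (auto simp: bij_betw_def)
    ultimately have inf: "\<phi> Infinity = Infinity"
      using hom[of Infinity Infinity] unit carrier[OF ell(1)] by simp
    have "bij_betw \<phi> (insert Infinity (?T V ` ?R V) - {Infinity}) (insert Infinity (?T W ` ?R W) - {Infinity})"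
      using bij inf by (intro bij_betw_DiffI) auto
    then have bij': "bij_betw \<phi> (?T V ` ?R V) (?T W ` ?R W)" using T_inf by (metis Diff_insert_absorb imageE)
    \<comment> \<open>\<open>inv_into\<close> reads off the abscissa.\<close>
    define \<psi> where "\<psi> = inv_into UNIV (?T W) \<circ> (\<phi> \<circ> ?T V)"
    have T_bij: "bij_betw (?T U) (?R U) (?T U ` ?R U)" for U
      unfolding bij_betw_def using T_inj by (auto simp: inj_on_def)
    have inv: "inv_into UNIV (?T W) (?T W x) = x" for x
      using T_inj by (intro inv_f_f) (simp add: inj_def)
    have "bij_betw (inv_into UNIV (?T W)) (?T W ` ?R W) (?R W)"
      unfolding bij_betw_def using inv by (auto simp: inj_on_def image_iff)
    then have "bij_betw \<psi> (?R V) (?R W)"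
      unfolding \<psi>_def by (intro bij_betw_trans[OF bij_betw_trans[OF T_bij bij']])
    moreover have "\<sigma> x \<in> ?R V \<and> \<psi> (\<sigma> x) = \<sigma> (\<psi> x)"
      if \<sigma>: "\<sigma> \<in> carrier abs_galois_group" and x: "x \<in> ?R V" for \<sigma> x
    proof -
      have xs: "x \<in> sep_closure" using sep[OF ell(1)] x by blast
      obtain y where y: "y \<in> ?R W" "\<phi> (?T V x) = ?T W y"
        using bij' x by (auto simp: bij_betw_def)
      have ys: "y \<in> sep_closure" using sep[OF ell(2)] y by blast
      have "\<phi> (?T V (\<sigma> x)) = ?T W (\<sigma> y)"
        using eqv[OF \<sigma>, of "?T V x"] T_galois[OF \<sigma>] carrier[OF ell(1)] x xs y ys by simp
      moreover have "\<sigma> x \<in> ?R V"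
      proof -
        have "poly (map_poly to_ac (two_division_poly V)) (\<sigma> x) = \<sigma> (to_ac 0)"
          using galois_poly[OF \<sigma> xs, of "two_division_poly V"] x by (simp add: two_division_roots_def)
        then show ?thesis using galois_const[OF \<sigma>, of 0] by (simp add: two_division_roots_def)
      qed
      ultimately show ?thesis using y by (simp add: \<psi>_def inv)
    qed
    ultimately show "equivariantly_bijective (?R V) (?R W)"
      unfolding equivariantly_bijective_def by blast
  next
    assume "equivariantly_bijective (?R V) (?R W)"
    then obtain \<psi> where bij: "bij_betw \<psi> (?R V) (?R W)"
      and eqv: "\<And>\<sigma> x. \<sigma> \<in> carrier abs_galois_group \<Longrightarrow> x \<in> ?R V \<Longrightarrow> \<sigma> x \<in> ?R V \<and> \<psi> (\<sigma> x) = \<sigma> (\<psi> x)"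
      unfolding equivariantly_bijective_def by blast
    have \<psi>_mem: "x \<in> ?R V \<Longrightarrow> \<psi> x \<in> ?R W" for x using bij by (auto simp: bij_betw_def)
    have \<psi>_inj: "x \<in> ?R V \<Longrightarrow> y \<in> ?R V \<Longrightarrow> \<psi> x = \<psi> y \<longleftrightarrow> x = y" for x y
      using bij by (auto simp: bij_betw_def inj_on_def)
    define \<phi> where "\<phi> = (\<lambda>P. if P = Infinity then Infinity else ?T W (\<psi> (inv_into UNIV (?T V) P)))"
    have inv: "inv_into UNIV (?T V) (?T V x) = x" for x
      using T_inj by (intro inv_f_f) (simp add: inj_def)
    have \<phi>_inf: "\<phi> Infinity = Infinity" and \<phi>_T: "\<phi> (?T V x) = ?T W (\<psi> x)" for x
      by (simp_all add: \<phi>_def T_inf inv)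
    have \<phi>_bij: "bij_betw \<phi> (carrier (two_torsion V)) (carrier (two_torsion W))"
      unfolding carrier[OF ell(1)] carrier[OF ell(2)] bij_betw_def
    proof (intro conjI)
      show "inj_on \<phi> (insert Infinity (?T V ` ?R V))"
        using \<psi>_inj by (auto simp: inj_on_def \<phi>_inf \<phi>_T T_inj T_inf T_inf[symmetric])
      show "\<phi> ` insert Infinity (?T V ` ?R V) = insert Infinity (?T W ` ?R W)"
        using bij by (simp add: \<phi>_inf \<phi>_T image_image bij_betw_def flip: image_image[of "?T W" \<psi>])
    qed
    have \<phi>_hom: "\<phi> (P \<otimes>\<^bsub>two_torsion V\<^esub> Q) = \<phi> P \<otimes>\<^bsub>two_torsion W\<^esub> \<phi> Q"
      if PQ: "P \<in> carrier (two_torsion V)" "Q \<in> carrier (two_torsion V)" for P Q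
    proof (cases "P = Infinity \<or> Q = Infinity")
      case True then show ?thesis using unit \<phi>_inf by metis
    next
      case False
      then obtain x y where xy: "x \<in> ?R V" "y \<in> ?R V" "P = ?T V x" "Q = ?T V y"
        using PQ carrier[OF ell(1)] by auto
      show ?thesis
      proof (cases "x = y")
        case True then show ?thesis using xy double \<phi>_T \<phi>_inf by metis
      next
        case False
        obtain z where z: "P \<otimes>\<^bsub>two_torsion V\<^esub> Q = ?T V z" "?R V = {x, y, z}" "z \<noteq> x" "z \<noteq> y"
          using third[OF ell(1) xy(1,2) False] xy by blast
        have ne: "\<psi> x \<noteq> \<psi> y" using \<psi>_inj xy False by blast
        obtain z' where z': "\<phi> P \<otimes>\<^bsub>two_torsion W\<^esub> \<phi> Q = ?T W z'" "?R W = {\<psi> x, \<psi> y, z'}"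
          using third[OF ell(2) \<psi>_mem[OF xy(1)] \<psi>_mem[OF xy(2)] ne] xy \<phi>_T by metis
        have "\<psi> z \<in> {\<psi> x, \<psi> y, z'}" "\<psi> z \<noteq> \<psi> x" "\<psi> z \<noteq> \<psi> y"
          using \<psi>_mem[of z] \<psi>_inj[of z] z z' xy by auto
        then show ?thesis using z(1) z'(1) \<phi>_T by simp
      qed
    qed
    have "\<phi> \<in> iso (two_torsion V) (two_torsion W)"
      using \<phi>_bij \<phi>_hom by (auto simp: iso_def hom_def bij_betw_def)
    moreover have "\<phi> (map_point \<sigma> P) = map_point \<sigma> (\<phi> P)"
      if \<sigma>: "\<sigma> \<in> carrier abs_galois_group" and P: "P \<in> carrier (two_torsion V)" for \<sigma> P
    proof (cases "P = Infinity")
      case False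
      then obtain x where x: "x \<in> ?R V" "P = ?T V x" using P carrier[OF ell(1)] by auto
      then have "x \<in> sep_closure" "\<psi> x \<in> sep_closure"
        using sep[OF ell(1)] sep[OF ell(2)] \<psi>_mem by auto
      then show ?thesis using T_galois[OF \<sigma>] eqv[OF \<sigma> x(1)] x \<phi>_T by simp
    qed (simp add: \<phi>_inf)
    ultimately show "two_torsion_isomorphic V W"
      unfolding two_torsion_isomorphic_def by blast
  qed
qed

section \<open>Quadratic maps between the roots of reduced cubics\<close>

text \<open>The coefficients of the reduced cubic whose roots are $ur^2 + vr + 2au/3$, where $r$ runs over
  the roots of $x^3 + ax + b$ (\<open>transform_split\<close>). The constant $2au/3$ makes the new roots sum to
  zero. The formulas express the elementary symmetric functions of the new roots.\<close>

definition transform_a :: "'k::field \<Rightarrow> 'k \<Rightarrow> 'k \<Rightarrow> 'k \<Rightarrow> 'k" where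
  "transform_a a b u v = (3 * a * v^2 + 9 * b * u * v - a^2 * u^2) / 3"

definition transform_b :: "'k::field \<Rightarrow> 'k \<Rightarrow> 'k \<Rightarrow> 'k \<Rightarrow> 'k" where
  "transform_b a b u v =
     b * v^3 - 2 * a^2 * u * v^2 / 3 - a * b * u^2 * v - b^2 * u^3 - 2 * a^3 * u^3 / 27"

text \<open>Replacing \<open>u\<close> by \<open>3 * t\<close> clears all denominators, so the identities below become polynomial
  identities with integer coefficients.\<close>

lemma transform_at_triple:
  assumes "(3::'k::field) \<noteq> 0"
  shows "transform_a a b (3 * t) v = a * v^2 + 9 * b * t * v - 3 * a^2 * (t::'k)^2"
    and "transform_b a b (3 * t) v =
      b * v^3 - 2 * a^2 * t * v^2 - 9 * a * b * t^2 * v - 27 * b^2 * t^3 - 2 * a^3 * t^3"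
proof -
  have "(27::'k) = 3^3" by simp
  then have 27: "(27::'k) \<noteq> 0" using assms by (metis power_not_zero)
  have "transform_a a b (3 * t) v = 3 * (a * v^2 + 9 * b * t * v - 3 * a^2 * t^2) / 3"
    by (simp add: transform_a_def algebra_simps power2_eq_square)
  then show "transform_a a b (3 * t) v = a * v^2 + 9 * b * t * v - 3 * a^2 * t^2"
    unfolding nonzero_mult_div_cancel_left[OF assms] .
  have eq1: "2 * a^2 * (3 * t) * v^2 / 3 = 2 * a^2 * t * v^2" using assms by simp
  have eq2: "2 * a^3 * (3 * t)^3 / 27 = 2 * a^3 * t^3" using 27 by (simp add: power_mult_distrib)
  show "transform_b a b (3 * t) v =
      b * v^3 - 2 * a^2 * t * v^2 - 9 * a * b * t^2 * v - 27 * b^2 * t^3 - 2 * a^3 * t^3"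
    unfolding transform_b_def eq1 eq2 by (simp add: power_mult_distrib)
qed

lemma transform_disc:
  assumes "(3::'k::field) \<noteq> 0"
  shows "4 * transform_a a b u v ^ 3 + 27 * transform_b a b u v ^ 2 =
     (4 * a^3 + 27 * b^2) * index_form a b u (v::'k) ^ 2"
proof -
  define t where "t = u / 3"
  have u: "u = 3 * t" using assms by (simp add: t_def)
  show ?thesis
    unfolding u transform_at_triple[OF assms] index_form_def
    by (simp add: algebra_simps power2_eq_square power3_eq_cube)
qed

lemma C_num_transform:
  assumes "(3::'k::field) \<noteq> 0"
  shows "C_num a b u (v::'k) = 27 * transform_a a b u v ^ 3"
proof -
  have "C_num a b u v = (3 * transform_a a b u v) ^ 3"
    by (simp only: C_num_def transform_a_def times_divide_eq_right nonzero_mult_div_cancel_left[OF assms])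
  then show ?thesis by (simp add: power_mult_distrib)
qed

lemma transform_split:
  fixes r1 r2 r3 u v :: "'k::field"
  assumes three: "(3::'k) \<noteq> 0" and r: "r1 + r2 + r3 = 0"
    and a: "r1 * r2 + r1 * r3 + r2 * r3 = a" and b: "r1 * r2 * r3 = - b"
    and h: "\<And>r. h r = u * r^2 + v * r + 2 * a * u / 3"
  shows "x^3 + transform_a a b u v * x + transform_b a b u v = (x - h r1) * (x - h r2) * (x - h r3)"
    and "h r1 - h r2 = (r1 - r2) * (v - u * r3)"
    and "h r1 - h r3 = (r1 - r3) * (v - u * r2)"
    and "h r2 - h r3 = (r2 - r3) * (v - u * r1)"
    and "index_form a b u v = (v - u * r1) * (v - u * r2) * (v - u * r3)"
proof -
  define t where "t = u / 3"
  have u: "u = 3 * t" using three by (simp add: t_def)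
  have h': "h r = 3 * t * r^2 + v * r + 2 * a * t" for r
    unfolding h u[symmetric] by (simp add: t_def)
  have r3: "r3 = - r1 - r2" using r by (simp add: eq_neg_iff_add_eq_0 algebra_simps)
  have b': "b = - (r1 * r2 * r3)" using b by simp
  show "x^3 + transform_a a b u v * x + transform_b a b u v = (x - h r1) * (x - h r2) * (x - h r3)"
    unfolding u transform_at_triple[OF three] h' a[symmetric] b' r3
    by (simp add: algebra_simps power2_eq_square power3_eq_cube)
  show "h r1 - h r2 = (r1 - r2) * (v - u * r3)" "h r1 - h r3 = (r1 - r3) * (v - u * r2)"
    "h r2 - h r3 = (r2 - r3) * (v - u * r1)"
    unfolding h r3 by (simp_all add: algebra_simps power2_eq_square)
  show "index_form a b u v = (v - u * r1) * (v - u * r2) * (v - u * r3)"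
    unfolding index_form_def a[symmetric] b' r3
    by (simp add: algebra_simps power2_eq_square power3_eq_cube)
qed

lemma to_ac_transform:
  "to_ac (transform_a a b u v) = transform_a (to_ac a) (to_ac b) (to_ac u) (to_ac v)"
  "to_ac (transform_b a b u v) = transform_b (to_ac a) (to_ac b) (to_ac u) (to_ac v)"
  "to_ac (index_form a b u v) = index_form (to_ac a) (to_ac b) (to_ac u) (to_ac v)"
  by (simp_all add: transform_a_def transform_b_def index_form_def)

lemma equivariantly_bijective_transform:
  fixes a b u v :: "'a::field"
  assumes three: "(3::'a) \<noteq> 0" and D: "4 * a^3 + 27 * b^2 \<noteq> 0" and index: "index_form a b u v \<noteq> 0"
  shows "equivariantly_bijective (cubic_roots a b) (cubic_roots (transform_a a b u v) (transform_b a b u v))"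
proof -
  have three': "(3::'a alg_closure) \<noteq> 0" using three to_ac_eq_0_iff[of "3::'a"] by simp
  obtain r1 r2 r3 where r: "r1 + r2 + r3 = 0" "r1 * r2 + r1 * r3 + r2 * r3 = to_ac a"
    "r1 * r2 * r3 = - to_ac b" "r1 \<noteq> r2" "r1 \<noteq> r3" "r2 \<noteq> r3" "cubic_roots a b = {r1, r2, r3}"
    by (rule cubic_roots_obtain[OF D])
  define h where "h r = to_ac u * r^2 + to_ac v * r + 2 * to_ac a * to_ac u / 3" for r
  note split = transform_split[OF three' r(1-3) h_def]
  have "index_form (to_ac a) (to_ac b) (to_ac u) (to_ac v) \<noteq> 0"
    using index by (simp flip: to_ac_transform)
  then have "h r1 \<noteq> h r2" "h r1 \<noteq> h r3" "h r2 \<noteq> h r3"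
    using split(2-5) r(4-6) by (metis mult_eq_0_iff right_minus_eq)+
  moreover have "cubic_roots (transform_a a b u v) (transform_b a b u v) = {h r1, h r2, h r3}"
    unfolding cubic_roots_def to_ac_transform split(1) by auto
  ultimately have "bij_betw h (cubic_roots a b) (cubic_roots (transform_a a b u v) (transform_b a b u v))"
    unfolding r(7) bij_betw_def by auto
  moreover have "poly (map_poly to_ac [:2 * a * u / 3, v, u:]) = h"
    by (rule ext) (simp add: h_def map_poly_pCons algebra_simps power2_eq_square)
  ultimately show ?thesis
    by (intro equivariantly_bijective_poly[OF cubic_roots_poly cubic_roots_separable[OF D],
          where h = "[:2 * a * u / 3, v, u:]"]) simp
qed

lemma equivariantly_bijective_twist:
  fixes A B d :: "'a::field"
  assumes D: "4 * A^3 + 27 * B^2 \<noteq> 0" and d: "d \<noteq> 0"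
  shows "equivariantly_bijective (cubic_roots A B) (cubic_roots (d^2 * A) (d^3 * B))"
proof -
  have scale: "(to_ac d * x)^3 + to_ac (d^2 * A) * (to_ac d * x) + to_ac (d^3 * B) =
      to_ac d^3 * (x^3 + to_ac A * x + to_ac B)" for x
    by (simp add: algebra_simps power2_eq_square power3_eq_cube)
  have "bij_betw (\<lambda>x. to_ac d * x) (cubic_roots A B) (cubic_roots (d^2 * A) (d^3 * B))"
    unfolding bij_betw_def
  proof (intro conjI subset_antisym subsetI)
    show "inj_on (\<lambda>x. to_ac d * x) (cubic_roots A B)" using d by (simp add: inj_on_def)
  next
    fix y assume "y \<in> (\<lambda>x. to_ac d * x) ` cubic_roots A B"
    then show "y \<in> cubic_roots (d^2 * A) (d^3 * B)"
      using scale by (auto simp: cubic_roots_def simp del: to_ac_mult to_ac_power)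
  next
    fix y assume y: "y \<in> cubic_roots (d^2 * A) (d^3 * B)"
    define x where "x = y / to_ac d"
    have yx: "y = to_ac d * x" using d by (simp add: x_def)
    then have "x \<in> cubic_roots A B"
      using y scale[of x] d by (simp add: cubic_roots_def del: to_ac_mult)
    then show "y \<in> (\<lambda>x. to_ac d * x) ` cubic_roots A B" using yx by blast
  qed
  moreover have "poly (map_poly to_ac [:0, d:]) = (\<lambda>x. to_ac d * x)"
    by (rule ext) (simp add: map_poly_pCons)
  ultimately show ?thesis
    by (intro equivariantly_bijective_poly[OF cubic_roots_poly cubic_roots_separable[OF D],
          where h = "[:0, d:]"]) simp
qed

text \<open>Equality of the $j$-invariants amounts to $A^3B'^2 = A'^3B^2$. The relations $d^2A = A'$ and
  $d^3B = B'$ leave only $d = (B'/B)/(A'/A)$, which satisfies them by this equality.\<close>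

lemma twist_exists:
  fixes A B A' B' :: "'k::field"
  assumes char: "(2::'k) \<noteq> 0" "(3::'k) \<noteq> 0"
    and D: "4 * A^3 + 27 * B^2 \<noteq> 0" and D': "4 * A'^3 + 27 * B'^2 \<noteq> 0"
    and j: "1728 * (4 * A^3) / (4 * A^3 + 27 * B^2) = 1728 * (4 * A'^3) / (4 * A'^3 + 27 * B'^2)"
    and "A' \<noteq> 0" "B' \<noteq> 0"
  obtains d where "d \<noteq> 0" "d^2 * A = A'" "d^3 * B = B'"
proof -
  note nz = numerals_nonzero[OF char]
  have "1728 * (4 * A^3) * (4 * A'^3 + 27 * B'^2) = 1728 * (4 * A'^3) * (4 * A^3 + 27 * B^2)"
    using j unfolding frac_eq_eq[OF D D'] .
  then have "1728 * 4 * 27 * (A^3 * B'^2) = 1728 * 4 * 27 * (A'^3 * B^2)"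
    by (simp add: algebra_simps)
  then have cross: "A^3 * B'^2 = A'^3 * B^2"
    using nz by (metis mult_cancel_left mult_eq_0_iff)
  have "A \<noteq> 0"
  proof
    assume "A = 0"
    with cross \<open>A' \<noteq> 0\<close> have "B = 0" by simp
    with \<open>A = 0\<close> D show False by simp
  qed
  then have "B \<noteq> 0" using cross \<open>B' \<noteq> 0\<close> by auto
  define d where "d = B' * A / (B * A')"
  have sq: "d^2 * A = A'"
  proof -
    have "d^2 * A = (A^3 * B'^2) / (B^2 * A'^2)"
      by (simp add: d_def power_divide power_mult_distrib power2_eq_square power3_eq_cube algebra_simps)
    also have "\<dots> = A'" unfolding cross using \<open>B \<noteq> 0\<close> \<open>A' \<noteq> 0\<close>
      by (simp add: power2_eq_square power3_eq_cube)
    finally show ?thesis .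
  qed
  have "d^3 * B = d * B / A * (d^2 * A)"
    using \<open>A \<noteq> 0\<close> by (simp add: power2_eq_square power3_eq_cube)
  also have "\<dots> = B'" unfolding sq using \<open>A \<noteq> 0\<close> \<open>B \<noteq> 0\<close> \<open>A' \<noteq> 0\<close> by (simp add: d_def)
  finally have "d^3 * B = B'" .
  moreover have "d \<noteq> 0" using \<open>A \<noteq> 0\<close> \<open>B \<noteq> 0\<close> \<open>A' \<noteq> 0\<close> \<open>B' \<noteq> 0\<close> by (simp add: d_def)
  ultimately show ?thesis using that sq by blast
qed

lemma quadratic_three_roots:
  fixes c0 c1 c2 :: "'k::field"
  assumes "x \<noteq> y" "x \<noteq> z" "y \<noteq> z"
    and "c2 * x^2 + c1 * x + c0 = 0" "c2 * y^2 + c1 * y + c0 = 0" "c2 * z^2 + c1 * z + c0 = 0"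
  shows "c2 = 0" "c1 = 0" "c0 = 0"
proof -
  have "(x - y) * (c2 * (x + y) + c1) = (c2 * x^2 + c1 * x + c0) - (c2 * y^2 + c1 * y + c0)"
    "(x - z) * (c2 * (x + z) + c1) = (c2 * x^2 + c1 * x + c0) - (c2 * z^2 + c1 * z + c0)"
    by (simp_all add: algebra_simps power2_eq_square)
  then have *: "c2 * (x + y) + c1 = 0" "c2 * (x + z) + c1 = 0" using assms by simp_all
  have "c2 * (y - z) = (c2 * (x + y) + c1) - (c2 * (x + z) + c1)" by (simp add: algebra_simps)
  then show c2: "c2 = 0" using * assms by simp
  then show "c1 = 0" using * by simp
  then show "c0 = 0" using c2 assms(4) by simp
qed

text \<open>Newton's interpolation formula: \<open>u\<close> is the second divided difference.\<close>

lemma quadratic_interpolation: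
  fixes r1 r2 r3 s1 s2 s3 :: "'k::field"
  assumes "r1 \<noteq> r2" "r1 \<noteq> r3" "r2 \<noteq> r3"
  defines "u \<equiv> ((s1 - s2) / (r1 - r2) - (s1 - s3) / (r1 - r3)) / (r2 - r3)"
  defines "v \<equiv> (s1 - s2) / (r1 - r2) - u * (r1 + r2)"
  defines "w \<equiv> s1 - u * r1 * r1 - v * r1"
  shows "s1 = u * r1^2 + v * r1 + w" "s2 = u * r2^2 + v * r2 + w" "s3 = u * r3^2 + v * r3 + w"
proof -
  show s1: "s1 = u * r1^2 + v * r1 + w" by (simp add: w_def power2_eq_square)
  have 1: "(s1 - s2) / (r1 - r2) = u * (r1 + r2) + v" by (simp add: v_def)
  then have "s1 - s2 = (u * (r1 + r2) + v) * (r1 - r2)" using assms(1) by (simp add: divide_eq_eq)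
  then have "s2 = s1 - (u * (r1 + r2) + v) * (r1 - r2)" by (simp add: algebra_simps)
  then show "s2 = u * r2^2 + v * r2 + w" unfolding s1 by (simp add: algebra_simps power2_eq_square)
  have "u * (r2 - r3) = (s1 - s2) / (r1 - r2) - (s1 - s3) / (r1 - r3)" using assms(3) by (simp add: u_def)
  then have "(s1 - s3) / (r1 - r3) = u * (r1 + r3) + v" unfolding 1 by (simp add: algebra_simps)
  then have "s1 - s3 = (u * (r1 + r3) + v) * (r1 - r3)" using assms(2) by (simp add: divide_eq_eq)
  then have "s3 = s1 - (u * (r1 + r3) + v) * (r1 - r3)" by (simp add: algebra_simps)
  then show "s3 = u * r3^2 + v * r3 + w" unfolding s1 by (simp add: algebra_simps power2_eq_square)
qed

text \<open>
  The interpolation polynomial of the bijection has separable coefficients. Conjugating it by an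
  endomorphism gives another quadratic that interpolates the same bijection, hence the same one, so
  its coefficients are in the base field. The roots of both cubics sum to zero, which determines the
  constant coefficient. Finally the two cubics \<open>x^3 + A * x + B\<close> and the one given by \<open>transform_a\<close>
  and \<open>transform_b\<close> share three different roots, so they are equal.
\<close>

lemma transform_of_equivariantly_bijective:
  fixes a b A B :: "'a::field"
  assumes three: "(3::'a) \<noteq> 0" and D: "4 * a^3 + 27 * b^2 \<noteq> 0" and D': "4 * A^3 + 27 * B^2 \<noteq> 0"
    and bij: "equivariantly_bijective (cubic_roots a b) (cubic_roots A B)"
  obtains u v where "index_form a b u v \<noteq> 0" "A = transform_a a b u v" "B = transform_b a b u v"
proof -
  have three': "(3::'a alg_closure) \<noteq> 0" using three to_ac_eq_0_iff[of "3::'a"] by simp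
  obtain r1 r2 r3 where r: "r1 + r2 + r3 = 0" "r1 * r2 + r1 * r3 + r2 * r3 = to_ac a"
    "r1 * r2 * r3 = - to_ac b" "r1 \<noteq> r2" "r1 \<noteq> r3" "r2 \<noteq> r3" "cubic_roots a b = {r1, r2, r3}"
    by (rule cubic_roots_obtain[OF D])
  obtain t1 t2 t3 where t: "t1 + t2 + t3 = 0" "t1 \<noteq> t2" "t1 \<noteq> t3" "t2 \<noteq> t3" "cubic_roots A B = {t1, t2, t3}"
    by (rule cubic_roots_obtain[OF D']) blast
  obtain \<psi> where \<psi>: "bij_betw \<psi> (cubic_roots a b) (cubic_roots A B)"
    and eqv: "\<And>\<sigma> x. \<sigma> \<in> carrier abs_galois_group \<Longrightarrow> x \<in> cubic_roots a b \<Longrightarrow>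
       \<sigma> x \<in> cubic_roots a b \<and> \<psi> (\<sigma> x) = \<sigma> (\<psi> x)"
    using bij unfolding equivariantly_bijective_def by blast
  define s1 s2 s3 where "s1 = \<psi> r1" "s2 = \<psi> r2" "s3 = \<psi> r3"
  note s_def = this
  have s_set: "cubic_roots A B = {s1, s2, s3}" and s_ne: "s1 \<noteq> s2" "s1 \<noteq> s3" "s2 \<noteq> s3"
    using \<psi> r(4-7) by (auto simp: bij_betw_def s_def)
  have "s1 + s2 + s3 = \<Sum>(cubic_roots A B)" unfolding s_set using s_ne by simp
  also have "\<dots> = t1 + t2 + t3" unfolding t(5) using t(2-4) by simp
  finally have s_sum: "s1 + s2 + s3 = 0" using t(1) by simp
  have sep: "cubic_roots a b \<subseteq> sep_closure" "cubic_roots A B \<subseteq> sep_closure"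
    using cubic_roots_separable D D' by blast+
  define u where "u = ((s1 - s2) / (r1 - r2) - (s1 - s3) / (r1 - r3)) / (r2 - r3)"
  define v where "v = (s1 - s2) / (r1 - r2) - u * (r1 + r2)"
  define w where "w = s1 - u * r1 * r1 - v * r1"
  note interp = quadratic_interpolation[OF r(4-6), where ?s1.0 = s1 and ?s2.0 = s2 and ?s3.0 = s3, folded u_def, folded v_def, folded w_def]
  have uv_sep: "u \<in> sep_closure" "v \<in> sep_closure"
  proof -
    have rs: "r1 \<in> sep_closure" "r2 \<in> sep_closure" "r3 \<in> sep_closure"
      "s1 \<in> sep_closure" "s2 \<in> sep_closure" "s3 \<in> sep_closure"
      using sep r(7) s_set by auto
    show u: "u \<in> sep_closure"
      unfolding u_def by (intro sep_closure_divide sep_closure_diff rs)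
    show "v \<in> sep_closure"
      unfolding v_def by (intro sep_closure_divide sep_closure_diff sep_closure_mult sep_closure_add rs u)
  qed
  have \<psi>_eq: "\<psi> x = u * x^2 + v * x + w" if "x \<in> cubic_roots a b" for x
  proof -
    have "x = r1 \<or> x = r2 \<or> x = r3" using that r(7) by simp
    then show ?thesis using interp s_def by metis
  qed
  have fixed: "\<tau> u = u \<and> \<tau> v = v" if \<tau>: "base_hom \<tau>" for \<tau>
  proof -
    note hom = base_hom_add[OF \<tau>] base_hom_mult[OF \<tau>]
    have quad: "(u - \<tau> u) * \<tau> x^2 + (v - \<tau> v) * \<tau> x + (w - \<tau> w) = 0" if x: "x \<in> cubic_roots a b" for x
    proof -
      have xs: "x \<in> sep_closure" "\<psi> x \<in> sep_closure"
        using sep x \<psi> by (auto simp: bij_betw_def)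
      have "\<tau> x \<in> cubic_roots a b" "\<psi> (\<tau> x) = \<tau> (\<psi> x)"
        using eqv[OF restrict_base_hom_galois[OF \<tau>] x] xs by auto
      then have "u * \<tau> x^2 + v * \<tau> x + w = \<tau> u * \<tau> x^2 + \<tau> v * \<tau> x + \<tau> w"
        using \<psi>_eq[OF x] \<psi>_eq[of "\<tau> x"] by (simp add: hom power2_eq_square)
      then show ?thesis by (simp add: algebra_simps)
    qed
    have ne: "\<tau> r1 \<noteq> \<tau> r2" "\<tau> r1 \<noteq> \<tau> r3" "\<tau> r2 \<noteq> \<tau> r3"
      using base_hom_inj[OF \<tau>] r(4-6) by (auto dest: injD)
    have "u - \<tau> u = 0" "v - \<tau> v = 0"
      using quadratic_three_roots[OF ne quad quad quad] r(7) by simp_all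
    then show ?thesis by simp
  qed
  then obtain u' v' where uv: "u = to_ac u'" "v = to_ac v'"
    using fixed_separable_in_base uv_sep by (metis rangeE)
  \<comment> \<open>Sum the three interpolation equations; the sum of the squares of the roots is \<open>- 2 * a\<close>.\<close>
  have "3 * w = 2 * to_ac a * u"
  proof -
    have "s1 + s2 + s3 = u * ((r1 + r2 + r3)^2 - 2 * (r1 * r2 + r1 * r3 + r2 * r3)) + v * (r1 + r2 + r3) + 3 * w"
      unfolding interp by (simp add: algebra_simps power2_eq_square)
    then show ?thesis unfolding s_sum r(1,2) by (simp add: algebra_simps)
  qed
  then have w: "w = 2 * to_ac a * to_ac u' / 3" using three' uv(1) by (simp add: field_simps)
  have "u * x^2 + v * x + w = u * x^2 + v * x + 2 * to_ac a * u / 3" for x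
    unfolding w uv ..
  note split = transform_split[OF three' r(1-3) this, folded interp]
  have ne: "index_form (to_ac a) (to_ac b) u v \<noteq> 0"
    using split(2-5) s_ne by auto
  let ?A = "transform_a (to_ac a) (to_ac b) u v" and ?B = "transform_b (to_ac a) (to_ac b) u v"
  \<comment> \<open>The difference of the cubics is linear and has three roots.\<close>
  have "0 * s^2 + (to_ac A - ?A) * s + (to_ac B - ?B) = 0" if "s \<in> {s1, s2, s3}" for s
  proof -
    have "s^3 + to_ac A * s + to_ac B = 0" using that s_set unfolding cubic_roots_def by blast
    moreover have "s^3 + ?A * s + ?B = 0" using that split(1)[of s] by auto
    ultimately have "(s^3 + to_ac A * s + to_ac B) - (s^3 + ?A * s + ?B) = 0" by simp
    then show ?thesis by (simp add: algebra_simps)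
  qed
  then have "to_ac A - ?A = 0" "to_ac B - ?B = 0"
    using quadratic_three_roots[OF s_ne, of 0 "to_ac A - ?A" "to_ac B - ?B"] by auto
  then have "A = transform_a a b u' v'" "B = transform_b a b u' v'"
    unfolding uv to_ac_transform[symmetric] right_minus_eq to_ac_eq_iff .
  moreover have "index_form a b u' v' \<noteq> 0"
    using ne unfolding uv to_ac_transform[symmetric] to_ac_eq_0_iff .
  ultimately show ?thesis using that by blast
qed

section \<open>The two conditions on the j-invariant\<close>

text \<open>Both conditions say that $j(E')$ is the $j$-invariant of the transformed cubic: its linear
  coefficient is a third of the base of the cube in the numerator of $C$, and its discriminant is
  that of $E$ times the square of the index form.\<close>

lemma
  fixes a b u v :: "'k::field"
  assumes char: "(2::'k) \<noteq> 0" "(3::'k) \<noteq> 0" and D: "4 * a^3 + 27 * b^2 \<noteq> 0"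
  defines "A \<equiv> transform_a a b u v" and "B \<equiv> transform_b a b u v"
  shows condition_i_iff: "a \<noteq> 0 \<Longrightarrow> condition_i a b E' u v \<longleftrightarrow>
      index_form a b u v \<noteq> 0 \<and> j_invariant E' = 1728 * (4 * A^3) / (4 * A^3 + 27 * B^2)"
    and condition_ii_iff: "b \<noteq> 0 \<Longrightarrow> condition_ii a b E' u v \<longleftrightarrow>
      index_form a b u v \<noteq> 0 \<and> j_invariant E' = 1728 * (4 * A^3) / (4 * A^3 + 27 * B^2)"
proof -
  note nz = numerals_nonzero[OF char]
  let ?I = "index_form a b u v" and ?D = "4 * a^3 + 27 * b^2"
  have jE: "j_invariant (short_weierstrass a b) = 1728 * (4 * a^3) / ?D"
    by (rule j_invariant_short[OF char(1)])
  have num: "C_num a b u v = 27 * A^3" unfolding A_def by (rule C_num_transform[OF char(2)])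
  have disc: "4 * A^3 + 27 * B^2 = ?D * ?I^2" unfolding A_def B_def by (rule transform_disc[OF char(2)])
  show "condition_i a b E' u v \<longleftrightarrow> ?I \<noteq> 0 \<and> j_invariant E' = 1728 * (4 * A^3) / (4 * A^3 + 27 * B^2)"
    if "a \<noteq> 0"
  proof (cases "?I = 0")
    case False
    have "4 * a^3 \<noteq> 0" using nz(1) that by simp
    then have nz': "1728 * (4 * a^3) / ?D \<noteq> 0"
      using nz(7) D by (metis divide_eq_0_iff mult_eq_0_iff)
    have "c * x / (c * k * i) * (m * (4 * k) / d) = m * (4 * x) / (d * i)"
      if "c \<noteq> 0" "k \<noteq> 0" for c k x i m d :: 'k
      using that by (simp add: ac_simps)
    from this[of 27 "a^3" "A^3" "?I^2" 1728 ?D]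
    have "C_fun a b u v * (1728 * (4 * a^3) / ?D) = 1728 * (4 * A^3) / (?D * ?I^2)"
      unfolding C_fun_def num using nz(4) that by (metis power_not_zero)
    then show ?thesis
      unfolding condition_i_def jE disc using False by (simp only: nonzero_divide_eq_eq[OF nz'] simp_thms)
  qed (simp add: condition_i_def)
  show "condition_ii a b E' u v \<longleftrightarrow> ?I \<noteq> 0 \<and> j_invariant E' = 1728 * (4 * A^3) / (4 * A^3 + 27 * B^2)"
    if "b \<noteq> 0"
  proof (cases "?I = 0")
    case False
    have "j_invariant (short_weierstrass a b) - 1728 = (1728 * (4 * a^3) - 1728 * ?D) / ?D"
      unfolding jE diff_divide_distrib nonzero_mult_div_cancel_right[OF D] ..
    also have "1728 * (4 * a^3) - 1728 * ?D = - (1728 * (27 * b^2))" by (simp add: algebra_simps)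
    finally have jE': "j_invariant (short_weierstrass a b) - 1728 = - (1728 * (27 * b^2)) / ?D" .
    have "27 * b^2 \<noteq> 0" using nz(4) that by simp
    then have nz': "- (1728 * (27 * b^2)) / ?D \<noteq> 0"
      using nz(7) D by (metis divide_eq_0_iff mult_eq_0_iff neg_equal_0_iff_equal)
    have "- 4 * (c * x / (c * i)) / k * (- (m * k) / d) = m * (4 * x) / (d * i)"
      if "c \<noteq> 0" "k \<noteq> 0" for c k x i m d :: 'k
      using that by (simp add: ac_simps)
    from this[of 27 "27 * b^2" "A^3" "?I^2" 1728 ?D]
    have "- 4 * Ca3_fun a b u v / (27 * b^2) * (- (1728 * (27 * b^2)) / ?D) =
        1728 * (4 * A^3) / (?D * ?I^2)"
      unfolding Ca3_fun_def num using nz(4) \<open>27 * b^2 \<noteq> 0\<close> by metis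
    then show ?thesis
      unfolding condition_ii_def jE' disc using False by (simp only: nonzero_divide_eq_eq[OF nz'] simp_thms)
  qed (simp add: condition_ii_def)
qed

theorem corollary2:
  fixes a b :: "'a::field" and E' :: "'a weierstrass"
  assumes "CHAR('a) \<noteq> 2" and "CHAR('a) \<noteq> 3"
    and "elliptic_curve (short_weierstrass a b)"
    and "elliptic_curve E'"
  shows "(j_invariant E' \<noteq> 0 \<and> j_invariant E' \<noteq> 1728 \<and>
            (\<exists>u v. (u, v) \<noteq> (0, 0) \<and>
               (a \<noteq> 0 \<and> condition_i a b E' u v \<or> b \<noteq> 0 \<and> condition_ii a b E' u v))
          \<longrightarrow> two_torsion_isomorphic E' (short_weierstrass a b)) \<and>
         (two_torsion_isomorphic E' (short_weierstrass a b) \<longrightarrow>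
            (\<exists>u v. (u, v) \<noteq> (0, 0) \<and>
               (a \<noteq> 0 \<longrightarrow> condition_i a b E' u v) \<and>
               (b \<noteq> 0 \<longrightarrow> condition_ii a b E' u v)))"
proof -
  note char = two_three_nonzero[OF assms(1,2)]
  let ?E = "short_weierstrass a b"
  define A' B' where "A' = reduced_a E'" "B' = reduced_b E'"
  note A'B' = this
  have D: "4 * a^3 + 27 * b^2 \<noteq> 0"
    using reduced_disc[OF char, of ?E] assms(3) unfolding elliptic_curve_def reduced_short[OF char]
    by (metis mult_zero_right neg_0_equal_iff_equal)
  have D': "4 * A'^3 + 27 * B'^2 \<noteq> 0"
    using reduced_disc[OF char, of E'] assms(4) unfolding elliptic_curve_def A'B'
    by (metis mult_zero_right neg_0_equal_iff_equal)
  have j': "j_invariant E' = 1728 * (4 * A'^3) / (4 * A'^3 + 27 * B'^2)"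
    unfolding A'B' by (rule j_invariant_reduced[OF char])
  have E: "equivariantly_bijective (two_division_roots ?E) (cubic_roots a b)"
    using two_division_roots_obtain[OF char assms(3)] unfolding reduced_short[OF char] by metis
  have E': "equivariantly_bijective (two_division_roots E') (cubic_roots A' B')"
    using two_division_roots_obtain[OF char assms(4)] unfolding A'B' by metis
  have iso_iff: "two_torsion_isomorphic E' ?E \<longleftrightarrow> equivariantly_bijective (cubic_roots a b) (cubic_roots A' B')"
    unfolding two_torsion_isomorphic_iff[OF char assms(4,3)]
    using E E' by (meson equivariantly_bijective_sym equivariantly_bijective_trans)
  note cond = condition_i_iff[OF char D] condition_ii_iff[OF char D]
  show ?thesis
  proof (intro conjI impI)
    assume "j_invariant E' \<noteq> 0 \<and> j_invariant E' \<noteq> 1728 \<and>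
            (\<exists>u v. (u, v) \<noteq> (0, 0) \<and>
               (a \<noteq> 0 \<and> condition_i a b E' u v \<or> b \<noteq> 0 \<and> condition_ii a b E' u v))"
    then obtain u v where j: "j_invariant E' \<noteq> 0" "j_invariant E' \<noteq> 1728"
      and "a \<noteq> 0 \<and> condition_i a b E' u v \<or> b \<noteq> 0 \<and> condition_ii a b E' u v" by blast
    let ?A = "transform_a a b u v" and ?B = "transform_b a b u v"
    have index: "index_form a b u v \<noteq> 0"
      and eq: "j_invariant E' = 1728 * (4 * ?A^3) / (4 * ?A^3 + 27 * ?B^2)"
      using \<open>a \<noteq> 0 \<and> _ \<or> _\<close> cond by blast+
    have disc: "4 * ?A^3 + 27 * ?B^2 \<noteq> 0"
      unfolding transform_disc[OF char(2)] using D index by simp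
    have "A' \<noteq> 0" using j(1) unfolding j' by auto
    have "B' \<noteq> 0"
    proof
      assume "B' = 0"
      then have "4 * A'^3 \<noteq> 0" using D' by simp
      then have "j_invariant E' = 1728" unfolding j' \<open>B' = 0\<close> by simp
      then show False using j(2) by simp
    qed
    obtain d where d: "d \<noteq> 0" "d^2 * ?A = A'" "d^3 * ?B = B'"
      using twist_exists[OF char disc D' eq[unfolded j', symmetric] \<open>A' \<noteq> 0\<close> \<open>B' \<noteq> 0\<close>] by blast
    show "two_torsion_isomorphic E' ?E"
      unfolding iso_iff
      using equivariantly_bijective_trans[OF equivariantly_bijective_transform[OF char(2) D index]
          equivariantly_bijective_twist[OF disc d(1)]] d(2,3) by simp
  next
    assume "two_torsion_isomorphic E' ?E"
    then obtain u v where uv: "index_form a b u v \<noteq> 0" "A' = transform_a a b u v" "B' = transform_b a b u v"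
      using transform_of_equivariantly_bijective[OF char(2) D D'] unfolding iso_iff by blast
    have "(u, v) \<noteq> (0, 0)" using uv(1) by (auto simp: index_form_def)
    moreover have "a \<noteq> 0 \<longrightarrow> condition_i a b E' u v" "b \<noteq> 0 \<longrightarrow> condition_ii a b E' u v"
      using cond uv(1) j' unfolding uv(2,3) by auto
    ultimately show "\<exists>u v. (u, v) \<noteq> (0, 0) \<and> (a \<noteq> 0 \<longrightarrow> condition_i a b E' u v) \<and>
               (b \<noteq> 0 \<longrightarrow> condition_ii a b E' u v)" by blast
  qed
qed

end
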